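(* Let $\mathcal{N}_1$ and $\mathcal{N}_2$ be any quantum channels whose input systems are both $\mathbb{C}^2$. Then their (asymptotic) zero-error classical capacity cannot be activated; that is, it is not the case that at least one of $\mathcal{C}_0(\mathcal{N}_1)$, $\mathcal{C}_0(\mathcal{N}_2)$ is $0$ and $$\mathcal{C}_0(\mathcal{N}_1\otimes\mathcal{N}_2)>\mathcal{C}_0(\mathcal{N}_1)+\mathcal{C}_0(\mathcal{N}_2).$$
   Context: A quantum channel with input system $\mathbb{C}^n$ is a completely positive trace-preserving map $\mathcal{N}:\mathcal{L}(\mathbb{C}^n)\to\mathcal{L}(\mathbb{C}^{n'})$, $\mathcal{N}(\rho)=\sum_iE_i\rho E_i^\dagger$ with Kraus operators $E_i$, $\sum_iE_i^\dagger E_i=I$ (finite-dimensional, arbitrary output dimension $n'$). Its noncommutative graph is $S(\mathcal{N})=\mathrm{span}\{E_i^\dagger E_j: i,j\}\subseteq\mathcal{L}(\mathbb{C}^n)$. Let $\alpha(\mathcal{N})$ be the maximum number $m$ of nonzero vectors $|\psi_1\rangle,\dots,|\psi_m\rangle\in\mathbb{C}^n$ such that $|\psi_s\rangle\langle\psi_t|\perp S(\mathcal{N})$ for all $s\neq t$, where $\perp$ is with respect to the Hilbert–Schmidt inner product $\langle X,Y\rangle=\mathrm{Tr}(X^\dagger Y)$. The one-shot zero-error classical capacity is $\mathcal{C}_0^{(1)}(\mathcal{N})=\log_2\alpha(\mathcal{N})$; it depends only on $S(\mathcal{N})$, and $S(\mathcal{N}_1\otimes\mathcal{N}_2)=S(\mathcal{N}_1)\otimes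 S(\mathcal{N}_2)$. The (asymptotic) zero-error classical capacity is $\mathcal{C}_0(\mathcal{N})=\lim_{k\to\infty}\frac1k\mathcal{C}_0^{(1)}(\mathcal{N}^{\otimes k})$. *)

theory Defs
  imports Complex_Main
    "Jordan_Normal_Form.VS_Connect"
    "Jordan_Normal_Form.Schur_Decomposition"
begin

section \<open>Matrices\<close>

definition mat_trace :: "complex mat \<Rightarrow> complex" where
  "mat_trace A = (\<Sum>i<dim_row A. A $$ (i, i))"

definition hs_inner :: "complex mat \<Rightarrow> complex mat \<Rightarrow> complex" where
  "hs_inner X Y = mat_trace (mat_adjoint X * Y)"

text \<open>The operator \<open>|\<psi>\<rangle>\<langle>\<phi>|\<close>.\<close>

definition ketbra :: "complex vec \<Rightarrow> complex vec \<Rightarrow> complex mat" where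
  "ketbra \<psi> \<phi> = mat (dim_vec \<psi>) (dim_vec \<phi>) (\<lambda>(i, j). \<psi> $ i * cnj (\<phi> $ j))"

definition mat_unit :: "nat \<Rightarrow> nat \<Rightarrow> nat \<Rightarrow> complex mat" where
  "mat_unit n i j = ketbra (unit_vec n i) (unit_vec n j)"

text \<open>The space \<open>\<complex>\<^sup>a \<otimes> \<complex>\<^sup>b\<close> is identified with \<open>\<complex>\<close>-vectors of length \<open>a * b\<close>,
  the basis vector \<open>e\<^sub>i \<otimes> f\<^sub>k\<close> having index \<open>i * b + k\<close>.\<close>

definition kron :: "complex mat \<Rightarrow> complex mat \<Rightarrow> complex mat" where
  "kron A B = mat (dim_row A * dim_row B) (dim_col A * dim_col B)
     (\<lambda>(r, c). A $$ (r div dim_row B, c div dim_col B) * B $$ (r mod dim_row B, c mod dim_col B))"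

text \<open>In the order used here, \<open>0 \<le> z\<close> on complex numbers includes that \<open>z\<close> is real.\<close>

definition psd :: "nat \<Rightarrow> complex mat \<Rightarrow> bool" where
  "psd n A \<longleftrightarrow> A \<in> carrier_mat n n \<and> (\<forall>v \<in> carrier_vec n. 0 \<le> (A *\<^sub>v v) \<bullet>c v)"

section \<open>Quantum channels\<close>

text \<open>A superoperator \<open>\<L>(\<complex>\<^sup>n) \<rightarrow> \<L>(\<complex>\<^sup>n\<^sup>')\<close> together with its dimensions;
  only the values of \<open>chan_map\<close> on \<open>carrier_mat n n\<close> are meaningful.\<close>

record channel =
  in_dim :: nat
  out_dim :: nat
  chan_map :: "complex mat \<Rightarrow> complex mat"

definition linear_channel :: "channel \<Rightarrow> bool" where
  "linear_channel N \<longleftrightarrow>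
     (\<forall>A \<in> carrier_mat (in_dim N) (in_dim N).
        chan_map N A \<in> carrier_mat (out_dim N) (out_dim N)) \<and>
     (\<forall>A \<in> carrier_mat (in_dim N) (in_dim N). \<forall>B \<in> carrier_mat (in_dim N) (in_dim N).
        chan_map N (A + B) = chan_map N A + chan_map N B) \<and>
     (\<forall>c. \<forall>A \<in> carrier_mat (in_dim N) (in_dim N).
        chan_map N (c \<cdot>\<^sub>m A) = c \<cdot>\<^sub>m chan_map N A)"

definition trace_preserving :: "channel \<Rightarrow> bool" where
  "trace_preserving N \<longleftrightarrow>
     (\<forall>A \<in> carrier_mat (in_dim N) (in_dim N). mat_trace (chan_map N A) = mat_trace A)"

definition id_channel :: "nat \<Rightarrow> channel" where
  "id_channel n = \<lparr>in_dim = n, out_dim = n, chan_map = (\<lambda>A. A)\<rparr>"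

text \<open>The tensor product of two linear maps: the linear map determined by
  \<open>(N \<otimes> M) (E\<^sub>i\<^sub>j \<otimes> E\<^sub>k\<^sub>l) = N E\<^sub>i\<^sub>j \<otimes> M E\<^sub>k\<^sub>l\<close>. The expansion of its argument in
  the matrix units \<open>E\<^sub>i\<^sub>j \<otimes> E\<^sub>k\<^sub>l\<close> is written out entry by entry.\<close>

definition tensor_channel :: "channel \<Rightarrow> channel \<Rightarrow> channel" where
  "tensor_channel N M =
     \<lparr>in_dim = in_dim N * in_dim M,
      out_dim = out_dim N * out_dim M,
      chan_map = (\<lambda>\<rho>. mat (out_dim N * out_dim M) (out_dim N * out_dim M)
        (\<lambda>(r, c). \<Sum>i<in_dim N. \<Sum>j<in_dim N. \<Sum>k<in_dim M. \<Sum>l<in_dim M.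
           \<rho> $$ (i * in_dim M + k, j * in_dim M + l) *
           kron (chan_map N (mat_unit (in_dim N) i j)) (chan_map M (mat_unit (in_dim M) k l))
             $$ (r, c)))\<rparr>"

fun tensor_power :: "channel \<Rightarrow> nat \<Rightarrow> channel" where
  "tensor_power N 0 = id_channel 1"
| "tensor_power N (Suc k) = tensor_channel N (tensor_power N k)"

definition completely_positive :: "channel \<Rightarrow> bool" where
  "completely_positive N \<longleftrightarrow>
     (\<forall>d \<rho>. psd (d * in_dim N) \<rho> \<longrightarrow>
        psd (d * out_dim N) (chan_map (tensor_channel (id_channel d) N) \<rho>))"

definition quantum_channel :: "channel \<Rightarrow> bool" where
  "quantum_channel N \<longleftrightarrow> linear_channel N \<and> completely_positive N \<and> trace_preserving N"

definition kraus_rep :: "channel \<Rightarrow> complex mat list \<Rightarrow> bool" where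
  "kraus_rep N Es \<longleftrightarrow>
     set Es \<subseteq> carrier_mat (out_dim N) (in_dim N) \<and>
     (\<forall>\<rho> \<in> carrier_mat (in_dim N) (in_dim N).
        chan_map N \<rho> =
          foldr (+) (map (\<lambda>E. E * \<rho> * mat_adjoint E) Es) (0\<^sub>m (out_dim N) (out_dim N)))"

section \<open>Noncommutative graph and zero-error capacities\<close>

text \<open>Every completely positive map has Kraus operators, and any two families of Kraus
  operators of the same map have the same span; so the following does not depend on the choice.\<close>

definition nc_graph :: "channel \<Rightarrow> complex mat set" where
  "nc_graph N =
     (let Es = (SOME Es. kraus_rep N Es) in
      LinearCombinations.module.span class_ring
        (module_mat TYPE(complex) (in_dim N) (in_dim N))
        {mat_adjoint E * F | E F. E \<in> set Es \<and> F \<in> set Es})"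

definition hs_orthogonal :: "complex mat \<Rightarrow> complex mat set \<Rightarrow> bool" where
  "hs_orthogonal X S \<longleftrightarrow> (\<forall>Y \<in> S. hs_inner X Y = 0)"

text \<open>The maximum exists for a quantum channel: \<open>nc_graph N\<close> contains the identity, so
  the vectors are pairwise orthogonal and \<open>m \<le> in_dim N\<close>.\<close>

definition independence_number :: "channel \<Rightarrow> nat" where
  "independence_number N =
     Max {m. \<exists>\<psi> :: nat \<Rightarrow> complex vec.
            (\<forall>s<m. \<psi> s \<in> carrier_vec (in_dim N) \<and> \<psi> s \<noteq> 0\<^sub>v (in_dim N)) \<and>
            (\<forall>s<m. \<forall>t<m. s \<noteq> t \<longrightarrow> hs_orthogonal (ketbra (\<psi> s) (\<psi> t)) (nc_graph N))}"

definition one_shot_zero_error_capacity :: "channel \<Rightarrow> real" where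
  "one_shot_zero_error_capacity N = log 2 (real (independence_number N))"

text \<open>The limit exists because the sequence
  \<open>\<lambda>k. one_shot_zero_error_capacity (tensor_power N k)\<close> is superadditive and at most
  \<open>k * log 2 (in_dim N)\<close>.\<close>

definition zero_error_capacity :: "channel \<Rightarrow> real" where
  "zero_error_capacity N =
     lim (\<lambda>k. one_shot_zero_error_capacity (tensor_power N k) / real k)"

end

theory Submission
  imports Defs "HOL-Computational_Algebra.Fundamental_Theorem_Algebra"
begin

text \<open>The capacity is in fact additive on qubit channels. Let \<open>S\<close> be the noncommutative graph of such
  a channel. If \<open>S\<close> is contained in some \<open>span {I, B}\<close>, then \<open>B\<close> is normal and an orthonormal
  eigenbasis of \<open>B\<close> consists of two independent vectors. Otherwise the traceless part of \<open>S\<close> has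
  dimension at least two, so the determinant has a zero on it: \<open>S\<close> contains a nilpotent
  \<open>N \<noteq> 0\<close>, and, after scaling, the curve \<open>N + t I + t\<^sup>2 N\<^sup>\<dagger>\<close> consists of matrices of rank one.

  For \<open>m\<close> independent vectors and \<open>M \<in> S\<close> the matrix \<open>\<langle>\<psi>\<^sub>s|M|\<psi>\<^sub>t\<rangle>\<close> is diagonal, so \<open>m\<close> is at most
  the rank of \<open>M\<close> as soon as no diagonal entry vanishes. None vanishes for \<open>M = I\<close>, hence none
  vanishes at a generic point of the curve. Choosing such points in one tensor factor after the
  other shows that this bound is multiplicative; so is the lower bound from product vectors.
  In both cases above they agree, with value \<open>2\<close> and \<open>1\<close> respectively.\<close>

section \<open>Bilinear pairing and tensor products of matrices\<close>

text \<open>Entries live at all natural indices and the dimension is passed to the operations, which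
  frees Kronecker products from carrier conditions. Matrices are then compared only at indices below
  the dimension.\<close>

type_synonym fmat = "nat \<Rightarrow> nat \<Rightarrow> complex"

text \<open>There is no conjugation, so as \<open>c\<close> varies \<open>pairing n c\<close> runs
  through all linear functionals on n by n matrices.\<close>

definition pairing :: "nat \<Rightarrow> fmat \<Rightarrow> fmat \<Rightarrow> complex" where
  "pairing n c A = (\<Sum>a<n. \<Sum>b<n. c a b * A a b)"

definition fid :: fmat where
  "fid a b = of_bool (a = b)"

definition fkron :: "nat \<Rightarrow> fmat \<Rightarrow> fmat \<Rightarrow> fmat" where
  "fkron m A B = (\<lambda>r c. A (r div m) (c div m) * B (r mod m) (c mod m))"

text \<open>Factoring through \<open>r\<close> dimensions is how rank at most \<open>r\<close> is
  expressed; only this inner dimension is recorded.\<close>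

definition fprod :: "nat \<Rightarrow> fmat \<Rightarrow> fmat \<Rightarrow> fmat" where
  "fprod r P Q = (\<lambda>a b. \<Sum>k<r. P a k * Q k b)"

text \<open>The entrywise conjugate of \<open>ketbra u v\<close>, so that pairing it with
  \<open>A\<close> gives the form <u|A|v>.\<close>

definition dyad :: "(nat \<Rightarrow> complex) \<Rightarrow> (nat \<Rightarrow> complex) \<Rightarrow> fmat" where
  "dyad u v = (\<lambda>a b. cnj (u a) * v b)"

section \<open>Sums over the index range of a tensor product\<close>

lemma mult_add_less_mult:
  fixes i j k l :: nat
  assumes "i < l" "j < k"
  shows "i * k + j < l * k"
proof -
  have "i * k + j < Suc i * k" using assms by simp
  also have "\<dots> \<le> l * k" using assms by (intro mult_right_mono) auto
  finally show ?thesis .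
qed

lemma sum_lessThan_mult:
  fixes g :: "nat \<Rightarrow> 'a::comm_monoid_add"
  shows "(\<Sum>r<n * m. g r) = (\<Sum>i<n. \<Sum>k<m. g (i * m + k))"
proof -
  have "(\<Sum>r<n * m. g r) = (\<Sum>i<n. sum g {i * m..<i * m + m})"
    by (rule sum.nat_group [symmetric])
  also have "\<dots> = (\<Sum>i<n. \<Sum>k<m. g (i * m + k))"
  proof (rule sum.cong [OF refl])
    fix i
    show "sum g {i * m..<i * m + m} = (\<Sum>k<m. g (i * m + k))"
      using sum.shift_bounds_nat_ivl [of g 0 "i * m" m]
      by (simp add: add.commute lessThan_atLeast0)
  qed
  finally show ?thesis .
qed

lemma sum_lessThan_mult_div_mod:
  fixes g :: "nat \<Rightarrow> nat \<Rightarrow> 'a::comm_monoid_add"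
  shows "(\<Sum>r<n * m. g (r div m) (r mod m)) = (\<Sum>i<n. \<Sum>k<m. g i k)"
  unfolding sum_lessThan_mult by (intro sum.cong refl) auto

section \<open>Linearity of the pairing and its behaviour on Kronecker products\<close>

lemma pairing_cong:
  assumes "\<And>a b. a < n \<Longrightarrow> b < n \<Longrightarrow> A a b = B a b"
  shows "pairing n c A = pairing n c B"
  unfolding pairing_def using assms by (intro sum.cong refl) auto

lemma pairing_add: "pairing n c (\<lambda>a b. A a b + B a b) = pairing n c A + pairing n c B"
  by (simp add: pairing_def sum.distrib algebra_simps)

lemma pairing_smult: "pairing n c (\<lambda>a b. z * A a b) = z * pairing n c A"
  by (simp add: pairing_def sum_distrib_left algebra_simps)

lemma pairing_sum:
  "pairing n c (\<lambda>a b. \<Sum>x\<in>X. z x * A x a b) = (\<Sum>x\<in>X. z x * pairing n c (A x))"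
proof -
  have "pairing n c (\<lambda>a b. \<Sum>x\<in>X. z x * A x a b)
      = (\<Sum>a<n. \<Sum>b<n. \<Sum>x\<in>X. z x * (c a b * A x a b))"
    unfolding pairing_def by (simp add: sum_distrib_left algebra_simps)
  also have "\<dots> = (\<Sum>a<n. \<Sum>x\<in>X. \<Sum>b<n. z x * (c a b * A x a b))"
    by (rule sum.cong [OF refl], rule sum.swap)
  also have "\<dots> = (\<Sum>x\<in>X. \<Sum>a<n. \<Sum>b<n. z x * (c a b * A x a b))"
    by (rule sum.swap)
  also have "\<dots> = (\<Sum>x\<in>X. z x * pairing n c (A x))"
    unfolding pairing_def by (simp add: sum_distrib_left)
  finally show ?thesis .
qed

text \<open>Contracting a functional on the tensor product with \<open>B\<close> leaves a functional
  on the first factor. This slicing lets later arguments treat one tensor factor at a time.\<close>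

lemma pairing_fkron:
  "pairing (n * m) c (fkron m A B)
    = pairing n (\<lambda>a b. pairing m (\<lambda>k l. c (a * m + k) (b * m + l)) B) A"
proof -
  have "pairing (n * m) c (fkron m A B)
      = (\<Sum>a<n. \<Sum>k<m. \<Sum>b<n. \<Sum>l<m. c (a * m + k) (b * m + l) * (A a b * B k l))"
    unfolding pairing_def fkron_def sum_lessThan_mult
    by (intro sum.cong refl) auto
  also have "\<dots> = (\<Sum>a<n. \<Sum>b<n. \<Sum>k<m. \<Sum>l<m. c (a * m + k) (b * m + l) * (A a b * B k l))"
    by (rule sum.cong [OF refl], rule sum.swap)
  also have "\<dots> = pairing n (\<lambda>a b. pairing m (\<lambda>k l. c (a * m + k) (b * m + l)) B) A"
    unfolding pairing_def by (simp add: sum_distrib_left sum_distrib_right algebra_simps)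
  finally show ?thesis .
qed

lemma pairing_fkron':
  "pairing (n * m) c (fkron m A B)
    = pairing m (\<lambda>k l. pairing n (\<lambda>a b. c (a * m + k) (b * m + l)) A) B"
proof -
  have "pairing (n * m) c (fkron m A B)
      = (\<Sum>a<n. \<Sum>b<n. \<Sum>k<m. \<Sum>l<m. c (a * m + k) (b * m + l) * (A a b * B k l))"
    unfolding pairing_fkron
    unfolding pairing_def by (simp add: sum_distrib_left sum_distrib_right algebra_simps)
  also have "\<dots> = (\<Sum>a<n. \<Sum>k<m. \<Sum>b<n. \<Sum>l<m. c (a * m + k) (b * m + l) * (A a b * B k l))"
    by (rule sum.cong [OF refl], rule sum.swap)
  also have "\<dots> = (\<Sum>k<m. \<Sum>a<n. \<Sum>b<n. \<Sum>l<m. c (a * m + k) (b * m + l) * (A a b * B k l))"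
    by (rule sum.swap)
  also have "\<dots> = (\<Sum>k<m. \<Sum>a<n. \<Sum>l<m. \<Sum>b<n. c (a * m + k) (b * m + l) * (A a b * B k l))"
    by (rule sum.cong [OF refl], rule sum.cong [OF refl], rule sum.swap)
  also have "\<dots> = (\<Sum>k<m. \<Sum>l<m. \<Sum>a<n. \<Sum>b<n. c (a * m + k) (b * m + l) * (A a b * B k l))"
    by (rule sum.cong [OF refl], rule sum.swap)
  also have "\<dots> = pairing m (\<lambda>k l. pairing n (\<lambda>a b. c (a * m + k) (b * m + l)) A) B"
    unfolding pairing_def by (simp add: sum_distrib_left sum_distrib_right algebra_simps)
  finally show ?thesis .
qed

lemma pairing_fkron_fkron:
  "pairing (n * m) (fkron m C D) (fkron m A B) = pairing n C A * pairing m D B"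
proof -
  have "pairing (n * m) (fkron m C D) (fkron m A B)
      = pairing n (\<lambda>a b. pairing m (\<lambda>k l. C a b * D k l) B) A"
    unfolding pairing_fkron unfolding pairing_def fkron_def
    by (intro sum.cong refl arg_cong2 [where f="(*)"]) auto
  also have "\<dots> = (\<Sum>a<n. \<Sum>b<n. C a b * A a b * pairing m D B)"
    unfolding pairing_def by (simp add: sum_distrib_left sum_distrib_right algebra_simps)
  also have "\<dots> = pairing n C A * pairing m D B"
    unfolding pairing_def [of n] by (simp add: sum_distrib_right)
  finally show ?thesis .
qed

lemma fkron_fid: "fkron m fid fid = fid"
proof (intro ext)
  fix a b
  have "a div m = b div m \<and> a mod m = b mod m \<longleftrightarrow> a = b"
    by (metis div_mult_mod_eq)
  then show "fkron m fid fid a b = fid a b"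
    unfolding fkron_def fid_def of_bool_conj [symmetric] by simp
qed

text \<open>The mixed-product rule; its purpose is that rank bounds multiply under tensor
  products.\<close>

lemma fkron_fprod:
  "fkron m (fprod r P Q) (fprod q P' Q')
    = fprod (r * q) (\<lambda>a k. P (a div m) (k div q) * P' (a mod m) (k mod q))
        (\<lambda>k b. Q (k div q) (b div m) * Q' (k mod q) (b mod m))"
proof (intro ext)
  fix a b
  have "fprod (r * q) (\<lambda>a k. P (a div m) (k div q) * P' (a mod m) (k mod q))
        (\<lambda>k b. Q (k div q) (b div m) * Q' (k mod q) (b mod m)) a b
      = (\<Sum>i<r. \<Sum>k<q. (P (a div m) i * P' (a mod m) k) * (Q i (b div m) * Q' k (b mod m)))"
    unfolding fprod_def
    by (rule sum_lessThan_mult_div_mod [where g = "\<lambda>i k. (P (a div m) i * P' (a mod m) k) * (Q i (b div m) * Q' k (b mod m))"])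
  also have "\<dots> = fkron m (fprod r P Q) (fprod q P' Q') a b"
    unfolding fkron_def fprod_def sum_product by (intro sum.cong refl) (simp add: algebra_simps)
  finally show "fkron m (fprod r P Q) (fprod q P' Q') a b
    = fprod (r * q) (\<lambda>a k. P (a div m) (k div q) * P' (a mod m) (k mod q))
        (\<lambda>k b. Q (k div q) (b div m) * Q' (k mod q) (b mod m)) a b" by simp
qed

section \<open>Independent vectors and matrices of bounded rank in the graph\<close>

text \<open>The linear span of \<open>G\<close> in \<open>\<L>(\<complex>\<^sup>n)\<close>, described as a double annihilator.\<close>

definition in_hull :: "nat \<Rightarrow> fmat set \<Rightarrow> fmat \<Rightarrow> bool" where
  "in_hull n G A \<longleftrightarrow> (\<forall>c. (\<forall>g\<in>G. pairing n c g = 0) \<longrightarrow> pairing n c A = 0)"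

definition gens_tensor :: "nat \<Rightarrow> fmat set \<Rightarrow> fmat set \<Rightarrow> fmat set" where
  "gens_tensor m G H = {fkron m A B | A B. A \<in> G \<and> B \<in> H}"

text \<open>A substitute for irreducibility: finitely many functionals that do not vanish at the identity
  do not vanish at a common element of the graph of rank at most \<open>r\<close>.\<close>

definition generic_rank :: "nat \<Rightarrow> fmat set \<Rightarrow> nat \<Rightarrow> bool" where
  "generic_rank n G r \<longleftrightarrow>
     (\<forall>C. finite C \<longrightarrow> (\<forall>c\<in>C. pairing n c fid \<noteq> 0) \<longrightarrow>
        (\<exists>P Q. in_hull n G (fprod r P Q) \<and> (\<forall>c\<in>C. pairing n c (fprod r P Q) \<noteq> 0)))"

definition independent_vectors :: "nat \<Rightarrow> fmat set \<Rightarrow> nat \<Rightarrow> (nat \<Rightarrow> nat \<Rightarrow> complex) \<Rightarrow> bool" where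
  "independent_vectors n G m \<psi> \<longleftrightarrow>
     (\<forall>s<m. \<exists>a<n. \<psi> s a \<noteq> 0) \<and>
     (\<forall>s<m. \<forall>t<m. s \<noteq> t \<longrightarrow> (\<forall>g\<in>G. pairing n (dyad (\<psi> s) (\<psi> t)) g = 0))"

section \<open>Closure properties of the hull and tensor products of generic ranks\<close>

lemma in_hullD:
  assumes "in_hull n G A" "\<And>g. g \<in> G \<Longrightarrow> pairing n c g = 0"
  shows "pairing n c A = 0"
  using assms unfolding in_hull_def by blast

lemma in_hull_base: "g \<in> G \<Longrightarrow> in_hull n G g"
  unfolding in_hull_def by blast

lemma in_hull_cong:
  assumes "in_hull n G A" "\<And>a b. a < n \<Longrightarrow> b < n \<Longrightarrow> A a b = B a b"
  shows "in_hull n G B"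
  using assms pairing_cong [of n A B] unfolding in_hull_def by metis

lemma in_hull_add:
  "in_hull n G A \<Longrightarrow> in_hull n G B \<Longrightarrow> in_hull n G (\<lambda>a b. A a b + B a b)"
  unfolding in_hull_def pairing_add by simp

lemma in_hull_smult: "in_hull n G A \<Longrightarrow> in_hull n G (\<lambda>a b. z * A a b)"
  unfolding in_hull_def pairing_smult by simp

text \<open>Slice an annihilating functional twice: its slice along any \<open>h\<close> in
  \<open>H\<close> annihilates \<open>G\<close>, hence \<open>A\<close>; so its slice along
  \<open>A\<close> annihilates \<open>H\<close>, hence \<open>B\<close>.\<close>

lemma in_hull_fkron:
  assumes A: "in_hull n G A" and B: "in_hull m H B"
  shows "in_hull (n * m) (gens_tensor m G H) (fkron m A B)"
  unfolding in_hull_def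
proof (intro allI impI)
  fix c
  assume c: "\<forall>g\<in>gens_tensor m G H. pairing (n * m) c g = 0"
  have "pairing (n * m) c (fkron m A h) = 0" if "h \<in> H" for h
    unfolding pairing_fkron
  proof (rule in_hullD [OF A])
    fix g assume "g \<in> G"
    then show "pairing n (\<lambda>a b. pairing m (\<lambda>k l. c (a * m + k) (b * m + l)) h) g = 0"
      using c that unfolding gens_tensor_def pairing_fkron [symmetric] by blast
  qed
  then show "pairing (n * m) c (fkron m A B) = 0"
    unfolding pairing_fkron' by (rule in_hullD [OF B])
qed

text \<open>The two factors are chosen one after the other. Slicing each \<open>c\<close> along the
  identity of the second factor gives \<open>C1\<close>, which determines the first element; slicing
  along that element gives \<open>C2\<close>. That \<open>C2\<close> does not vanish at the identity
  is exactly the property by which the first element was chosen.\<close>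

lemma generic_rank_tensor:
  assumes R: "generic_rank n G r" and R': "generic_rank m H q"
  shows "generic_rank (n * m) (gens_tensor m G H) (r * q)"
  unfolding generic_rank_def
proof (intro allI impI)
  fix C :: "fmat set"
  assume fin: "finite C" and C: "\<forall>c\<in>C. pairing (n * m) c fid \<noteq> 0"
  define C1 where "C1 = (\<lambda>c a b. pairing m (\<lambda>k l. c (a * m + k) (b * m + l)) fid) ` C"
  have "finite C1" "\<forall>c\<in>C1. pairing n c fid \<noteq> 0"
    using fin C unfolding C1_def by (auto simp: pairing_fkron [symmetric] fkron_fid)
  then obtain P Q where PQ: "in_hull n G (fprod r P Q)"
      "\<forall>c\<in>C1. pairing n c (fprod r P Q) \<noteq> 0"
    using R unfolding generic_rank_def by blast
  define C2 where
    "C2 = (\<lambda>c k l. pairing n (\<lambda>a b. c (a * m + k) (b * m + l)) (fprod r P Q)) ` C"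
  have "finite C2" "\<forall>c\<in>C2. pairing m c fid \<noteq> 0"
    using fin PQ(2) unfolding C2_def C1_def
    by (auto simp: pairing_fkron' [symmetric]) (auto simp: pairing_fkron)
  then obtain P' Q' where PQ': "in_hull m H (fprod q P' Q')"
      "\<forall>c\<in>C2. pairing m c (fprod q P' Q') \<noteq> 0"
    using R' unfolding generic_rank_def by blast
  have "in_hull (n * m) (gens_tensor m G H) (fkron m (fprod r P Q) (fprod q P' Q'))"
    by (rule in_hull_fkron [OF PQ(1) PQ'(1)])
  moreover have "\<forall>c\<in>C. pairing (n * m) c (fkron m (fprod r P Q) (fprod q P' Q')) \<noteq> 0"
    using PQ'(2) unfolding C2_def by (simp add: pairing_fkron')
  ultimately show "\<exists>P Q. in_hull (n * m) (gens_tensor m G H) (fprod (r * q) P Q)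
      \<and> (\<forall>c\<in>C. pairing (n * m) c (fprod (r * q) P Q) \<noteq> 0)"
    unfolding fkron_fprod by blast
qed

lemma fprod_fid: "a < n \<Longrightarrow> fprod n fid fid a b = fid a b"
proof -
  assume "a < n"
  have "(\<Sum>k<n. fid a k * fid k b) = (\<Sum>k<n. if k = a then fid a b else 0)"
    by (rule sum.cong) (auto simp: fid_def)
  then show ?thesis using \<open>a < n\<close> by (simp add: fprod_def)
qed

text \<open>The identity itself serves as the common element for every \<open>C\<close>.\<close>

lemma generic_rank_dim:
  assumes "in_hull n G fid"
  shows "generic_rank n G n"
  unfolding generic_rank_def
proof (intro allI impI)
  fix C assume C: "\<forall>c\<in>C. pairing n c fid \<noteq> 0"
  have "in_hull n G (fprod n fid fid)"
    by (rule in_hull_cong [OF assms]) (simp add: fprod_fid)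
  moreover have "pairing n c (fprod n fid fid) = pairing n c fid" for c
    by (rule pairing_cong) (simp add: fprod_fid)
  ultimately show "\<exists>P Q. in_hull n G (fprod n P Q) \<and> (\<forall>c\<in>C. pairing n c (fprod n P Q) \<noteq> 0)"
    using C by (intro exI [of _ fid]) auto
qed

text \<open>The \<open>r\<close> equations are padded with zero rows to a square system; its row
  \<open>r\<close> is zero, so its determinant vanishes.\<close>

lemma exists_nonzero_kernel_vector:
  fixes Q :: "nat \<Rightarrow> nat \<Rightarrow> complex"
  assumes "r < m"
  shows "\<exists>x. (\<exists>t<m. x t \<noteq> 0) \<and> (\<forall>k<r. (\<Sum>t<m. Q k t * x t) = 0)"
proof -
  define M where "M = mat m m (\<lambda>(k, t). if k < r then Q k t else 0)"
  have M: "M \<in> carrier_mat m m" by (simp add: M_def)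
  have "M = mat\<^sub>r m m (\<lambda>i. if i = r then 0\<^sub>v m else row M i)"
    using assms by (intro eq_matI) (simp_all add: M_def)
  moreover have "det (mat\<^sub>r m m (\<lambda>i. if i = r then 0\<^sub>v m else row M i)) = 0"
    using M by (intro det_row_0 [OF assms]) auto
  ultimately have "det M = 0" by simp
  then obtain v where v: "v \<in> carrier_vec m" "v \<noteq> 0\<^sub>v m" "M *\<^sub>v v = 0\<^sub>v m"
    using det_0_iff_vec_prod_zero [OF M] by blast
  have "\<exists>t<m. v $ t \<noteq> 0"
    using v(1,2) by (auto simp: vec_eq_iff)
  moreover have "(\<Sum>t<m. Q k t * v $ t) = 0" if "k < r" for k
  proof -
    have "(M *\<^sub>v v) $ k = (\<Sum>t<m. Q k t * v $ t)"
      using that assms v(1) by (simp add: M_def scalar_prod_def lessThan_atLeast0)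
    then show ?thesis using v(3) that assms by simp
  qed
  ultimately show ?thesis by blast
qed

lemma pairing_dyad_fid: "pairing n (dyad u u) fid = of_real (\<Sum>a<n. (cmod (u a))\<^sup>2)"
proof -
  have "pairing n (dyad u u) fid = (\<Sum>a<n. cnj (u a) * u a)"
    unfolding pairing_def dyad_def fid_def by (simp add: of_bool_def if_distrib sum.If_cases)
  also have "\<dots> = (\<Sum>a<n. of_real ((cmod (u a))\<^sup>2))"
    by (intro sum.cong refl) (metis complex_norm_square mult.commute)
  finally show ?thesis by simp
qed

lemma pairing_dyad_fid_nonzero:
  assumes "\<exists>a<n. u a \<noteq> 0"
  shows "pairing n (dyad u u) fid \<noteq> 0"
proof -
  have "(\<Sum>a<n. (cmod (u a))\<^sup>2) > 0"
    using assms by (auto intro!: sum_pos2)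
  then show ?thesis unfolding pairing_dyad_fid by (metis less_irrefl of_real_eq_0_iff)
qed

text \<open>A Haemers-type bound: the matrix \<open>\<langle>\<psi>\<^sub>s|PQ|\<psi>\<^sub>t\<rangle>\<close> is diagonal with nonzero
  diagonal, but has rank at most \<open>r\<close>.\<close>

lemma independent_vectors_le:
  assumes R: "generic_rank n G r" and I: "independent_vectors n G m \<psi>"
  shows "m \<le> r"
proof (rule ccontr)
  assume "\<not> m \<le> r"
  then have "r < m" by simp
  define C where "C = (\<lambda>s. dyad (\<psi> s) (\<psi> s)) ` {..<m}"
  have "finite C" "\<forall>c\<in>C. pairing n c fid \<noteq> 0"
    using I unfolding C_def independent_vectors_def by (auto intro!: pairing_dyad_fid_nonzero)
  then obtain P Q where PQ: "in_hull n G (fprod r P Q)"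
      "\<forall>c\<in>C. pairing n c (fprod r P Q) \<noteq> 0"
    using R unfolding generic_rank_def by blast
  define D where "D s t = pairing n (dyad (\<psi> s) (\<psi> t)) (fprod r P Q)" for s t
  define Q' where "Q' k t = (\<Sum>b<n. Q k b * \<psi> t b)" for k t
  define P' where "P' s k = (\<Sum>a<n. cnj (\<psi> s a) * P a k)" for s k
  have D_eq: "D s t = (\<Sum>k<r. P' s k * Q' k t)" for s t
  proof -
    have "D s t = (\<Sum>a<n. \<Sum>b<n. \<Sum>k<r. cnj (\<psi> s a) * P a k * (Q k b * \<psi> t b))"
      unfolding D_def pairing_def dyad_def fprod_def by (simp add: sum_distrib_left algebra_simps)
    also have "\<dots> = (\<Sum>a<n. \<Sum>k<r. \<Sum>b<n. cnj (\<psi> s a) * P a k * (Q k b * \<psi> t b))"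
      by (rule sum.cong [OF refl], rule sum.swap)
    also have "\<dots> = (\<Sum>k<r. \<Sum>a<n. \<Sum>b<n. cnj (\<psi> s a) * P a k * (Q k b * \<psi> t b))"
      by (rule sum.swap)
    also have "\<dots> = (\<Sum>k<r. P' s k * Q' k t)"
      unfolding P'_def Q'_def by (simp add: sum_product)
    finally show ?thesis .
  qed
  \<comment> \<open>The rank bound enters as a nonzero \<open>x\<close> with \<open>D x = 0\<close>.
    Since \<open>D\<close> is diagonal, an index \<open>s\<close> with \<open>x s \<noteq> 0\<close>
    would force \<open>D s s = 0\<close>.\<close>
  obtain x where x: "\<exists>t<m. x t \<noteq> 0" "\<forall>k<r. (\<Sum>t<m. Q' k t * x t) = 0"
    using exists_nonzero_kernel_vector [OF \<open>r < m\<close>] by blast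
  obtain s where s: "s < m" "x s \<noteq> 0" using x(1) by blast
  have off: "D s t = 0" if "t < m" "t \<noteq> s" for t
    unfolding D_def using I that s(1) unfolding independent_vectors_def
    by (intro in_hullD [OF PQ(1)]) auto
  have "(\<Sum>t<m. D s t * x t) = (\<Sum>t<m. \<Sum>k<r. P' s k * (Q' k t * x t))"
    unfolding D_eq by (simp add: sum_distrib_right mult.assoc)
  also have "\<dots> = (\<Sum>k<r. \<Sum>t<m. P' s k * (Q' k t * x t))"
    by (rule sum.swap)
  also have "\<dots> = 0"
    using x(2) by (simp add: sum_distrib_left [symmetric])
  finally have "(\<Sum>t<m. D s t * x t) = 0" .
  moreover have "(\<Sum>t<m. D s t * x t) = D s s * x s"
  proof -
    have "(\<Sum>t<m. D s t * x t) = (\<Sum>t\<in>{s}. D s t * x t)"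
      using s(1) off by (intro sum.mono_neutral_right) auto
    then show ?thesis by simp
  qed
  moreover have "D s s \<noteq> 0"
    using PQ(2) s(1) unfolding D_def C_def by simp
  ultimately show False using s(2) by simp
qed

text \<open>The vectors are product vectors, for which the pairing with a generator factorizes.
  Distinct indices differ in their quotient or in their remainder modulo \<open>l\<close>, so at
  least one of the factors vanishes.\<close>

lemma independent_vectors_tensor:
  assumes I: "independent_vectors n G k \<psi>" and J: "independent_vectors m H l \<phi>"
  shows "independent_vectors (n * m) (gens_tensor m G H) (k * l)
    (\<lambda>s a. \<psi> (s div l) (a div m) * \<phi> (s mod l) (a mod m))"
proof -
  have *: "s div l < k \<and> s mod l < l" if "s < k * l" for s
    using that by (metis less_mult_imp_div_less mod_less_divisor mult_0_right not_less_zero neq0_conv)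
  have "\<exists>a<n * m. \<psi> (s div l) (a div m) * \<phi> (s mod l) (a mod m) \<noteq> 0" if s: "s < k * l" for s
  proof -
    obtain a where a: "a < n" "\<psi> (s div l) a \<noteq> 0"
      using I * [OF s] unfolding independent_vectors_def by blast
    obtain b where b: "b < m" "\<phi> (s mod l) b \<noteq> 0"
      using J * [OF s] unfolding independent_vectors_def by blast
    show ?thesis
      using a b mult_add_less_mult by (intro exI [of _ "a * m + b"]) auto
  qed
  moreover have "pairing (n * m) (dyad (\<lambda>a. \<psi> (s div l) (a div m) * \<phi> (s mod l) (a mod m))
      (\<lambda>a. \<psi> (t div l) (a div m) * \<phi> (t mod l) (a mod m))) g = 0"
    if s: "s < k * l" and t: "t < k * l" and ne: "s \<noteq> t" and g: "g \<in> gens_tensor m G H" for s t g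
  proof -
    obtain A B where AB: "A \<in> G" "B \<in> H" and g_eq: "g = fkron m A B"
      using g unfolding gens_tensor_def by blast
    have "dyad (\<lambda>a. \<psi> (s div l) (a div m) * \<phi> (s mod l) (a mod m))
        (\<lambda>a. \<psi> (t div l) (a div m) * \<phi> (t mod l) (a mod m))
      = fkron m (dyad (\<psi> (s div l)) (\<psi> (t div l))) (dyad (\<phi> (s mod l)) (\<phi> (t mod l)))"
      unfolding dyad_def fkron_def by (simp add: algebra_simps)
    then have eq: "pairing (n * m) (dyad (\<lambda>a. \<psi> (s div l) (a div m) * \<phi> (s mod l) (a mod m))
        (\<lambda>a. \<psi> (t div l) (a div m) * \<phi> (t mod l) (a mod m))) g
      = pairing n (dyad (\<psi> (s div l)) (\<psi> (t div l))) A * pairing m (dyad (\<phi> (s mod l)) (\<phi> (t mod l))) B"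
      unfolding g_eq by (simp add: pairing_fkron_fkron)
    have "s div l \<noteq> t div l \<or> s mod l \<noteq> t mod l"
      using ne by (metis div_mult_mod_eq)
    then show ?thesis
      unfolding eq using I J * [OF s] * [OF t] AB unfolding independent_vectors_def by auto
  qed
  ultimately show ?thesis
    unfolding independent_vectors_def by auto
qed

section \<open>Operator systems on a qubit\<close>

definition fadj :: "fmat \<Rightarrow> fmat" where
  "fadj A = (\<lambda>a b. cnj (A b a))"

lemma pairing_fadj: "pairing n c (fadj A) = cnj (pairing n (fadj c) A)"
proof -
  have "pairing n c (fadj A) = (\<Sum>b<n. \<Sum>a<n. c a b * cnj (A b a))"
    unfolding pairing_def fadj_def by (rule sum.swap)
  then show ?thesis unfolding pairing_def fadj_def by simp
qed

lemma in_hull_fadj: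
  assumes G: "\<And>g. g \<in> G \<Longrightarrow> fadj g \<in> G" and A: "in_hull n G A"
  shows "in_hull n G (fadj A)"
  unfolding in_hull_def
proof (intro allI impI)
  fix c assume c: "\<forall>g\<in>G. pairing n c g = 0"
  have "pairing n (fadj c) A = 0"
  proof (rule in_hullD [OF A])
    fix g assume "g \<in> G"
    then have "pairing n c (fadj g) = 0" using c G by blast
    then show "pairing n (fadj c) g = 0" unfolding pairing_fadj by simp
  qed
  then show "pairing n c (fadj A) = 0" unfolding pairing_fadj by simp
qed

lemma pairing_2: "pairing 2 c A = c 0 0 * A 0 0 + c 0 1 * A 0 1 + c 1 0 * A 1 0 + c 1 1 * A 1 1"
  by (simp add: pairing_def numeral_2_eq_2 add.assoc)

text \<open>If the first row is nonzero, the second is a multiple of it; if it is zero, the second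
  row itself is the row factor.\<close>

lemma singular_2x2_factor:
  fixes M :: fmat
  assumes "M 0 0 * M 1 1 = M 0 1 * M 1 0"
  shows "\<exists>P Q. \<forall>a<2. \<forall>b<2. M a b = fprod 1 P Q a b"
proof -
  have *: ?thesis if "M 0 0 = p * x" "M 0 1 = p * y" "M 1 0 = q * x" "M 1 1 = q * y" for p q x y
  proof (intro exI allI impI)
    fix a b :: nat assume "a < 2" "b < 2"
    then show "M a b = fprod 1 (\<lambda>a _. if a = 0 then p else q) (\<lambda>_ b. if b = 0 then x else y) a b"
      using that by (auto simp: fprod_def dest!: less_2_cases)
  qed
  consider "M 0 0 \<noteq> 0" | "M 0 0 = 0" "M 0 1 \<noteq> 0" | "M 0 0 = 0" "M 0 1 = 0" by blast
  then show ?thesis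
  proof cases
    case 1
    then show ?thesis using assms by (intro * [of 1 "M 0 0" "M 0 1" "M 1 0 / M 0 0"]) (auto simp: field_simps)
  next
    case 2
    then show ?thesis using assms by (intro * [of 1 "M 0 0" "M 0 1" "M 1 1 / M 0 1"]) (auto simp: field_simps)
  next
    case 3
    then show ?thesis by (intro * [of 0 "M 1 0" "M 1 1" 1]) auto
  qed
qed

text \<open>Only the linear coefficient is under control in the application, where it is the value
  of a functional at the identity; the polynomial may have degree one.\<close>

lemma finite_quadratic_roots:
  fixes a b c :: complex
  assumes "b \<noteq> 0"
  shows "finite {t. a + t * b + t\<^sup>2 * c = 0}"
proof -
  have "finite {t. poly [:a, b, c:] t = 0}"
    using assms by (intro poly_roots_finite) simp
  then show ?thesis by (simp add: algebra_simps power2_eq_square)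
qed

lemma quadratic_has_root:
  fixes a b c :: complex
  assumes "c \<noteq> 0"
  shows "\<exists>t. a + t * b + t\<^sup>2 * c = 0"
proof -
  have "\<exists>t. poly [:a, b, c:] t = 0"
    using assms by (intro fundamental_theorem_of_algebra_alt) auto
  then show ?thesis by (simp add: algebra_simps power2_eq_square)
qed

text \<open>A nilpotent \<open>N\<close> in the operator system yields the curve \<open>N + t I + t\<^sup>2 \<nu> N\<^sup>\<dagger>\<close> with
  \<open>\<nu> = 1 / Tr (N\<^sup>\<dagger> N)\<close>, all of whose points are singular. A functional not vanishing at the
  identity restricts to a nonzero polynomial in \<open>t\<close>.\<close>

lemma generic_rank_qubit_nilpotent:
  assumes one: "in_hull 2 G fid"
    and N: "in_hull 2 G N" and Nadj: "in_hull 2 G (fadj N)"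
    and tr: "N 0 0 + N 1 1 = 0" and det: "N 0 0 * N 1 1 = N 0 1 * N 1 0"
    and nz: "\<exists>a<2. \<exists>b<2. N a b \<noteq> 0"
  shows "generic_rank 2 G 1"
  unfolding generic_rank_def
proof (intro allI impI)
  fix C :: "fmat set"
  assume fin: "finite C" and C: "\<forall>c\<in>C. pairing 2 c fid \<noteq> 0"
  \<comment> \<open>This is Tr(N^\<dagger> N), a sum of squared moduli of the entries, hence
    nonzero.\<close>
  define w where "w = N 0 0 * cnj (N 0 0) + N 0 1 * cnj (N 0 1) + N 1 0 * cnj (N 1 0) + N 1 1 * cnj (N 1 1)"
  have "w = of_real ((cmod (N 0 0))\<^sup>2 + (cmod (N 0 1))\<^sup>2 + (cmod (N 1 0))\<^sup>2 + (cmod (N 1 1))\<^sup>2)"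
    unfolding w_def by (simp add: complex_norm_square [symmetric] del: of_real_power)
  moreover have "(cmod (N 0 0))\<^sup>2 + (cmod (N 0 1))\<^sup>2 + (cmod (N 1 0))\<^sup>2 + (cmod (N 1 1))\<^sup>2 \<noteq> 0"
    using nz by (auto dest!: less_2_cases simp: add_nonneg_eq_0_iff)
  ultimately have w: "w \<noteq> 0" by (metis of_real_eq_0_iff)
  define M where "M t = (\<lambda>a b. (N a b + t * fid a b) + (t\<^sup>2 / w) * fadj N a b)" for t
  have hull: "in_hull 2 G (M t)" for t
    unfolding M_def by (intro in_hull_add in_hull_smult N Nadj one)
  \<comment> \<open>Each functional excludes only the finitely many roots of a polynomial in
    \<open>t\<close>, so some \<open>t\<close> avoids all of them.\<close>
  have "finite (\<Union>c\<in>C. {t. pairing 2 c N + t * pairing 2 c fid + t\<^sup>2 * (pairing 2 c (fadj N) / w) = 0})"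
    using fin C by (intro finite_UN_I finite_quadratic_roots) auto
  then obtain t where t: "\<forall>c\<in>C. pairing 2 c N + t * pairing 2 c fid + t\<^sup>2 * (pairing 2 c (fadj N) / w) \<noteq> 0"
    using ex_new_if_finite [OF infinite_UNIV_char_0] by blast
  have pM: "pairing 2 c (M t) \<noteq> 0" if "c \<in> C" for c
    using t that unfolding M_def pairing_add pairing_smult by (simp add: field_simps)
  have N11: "N 1 1 = - N 0 0" using tr by (simp add: eq_neg_iff_add_eq_0 add.commute)
  have d: "N 0 1 * N 1 0 = - (N 0 0 * N 0 0)" using det N11 by simp
  have d': "cnj (N 0 1) * cnj (N 1 0) = - (cnj (N 0 0) * cnj (N 0 0))"
    using arg_cong [OF d, of cnj] by simp
  \<comment> \<open>For traceless \<open>N\<close> the determinant of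
    \<open>N + t I + q N\<^sup>\<dagger>\<close> is \<open>t\<^sup>2 - q w\<close> plus multiples of
    det N and its conjugate. The latter two vanish, and this \<open>q\<close> cancels the
    rest.\<close>
  define q where "q = t\<^sup>2 / w"
  have qw: "q * w = t\<^sup>2" using w by (simp add: q_def)
  have M: "M t 0 0 = N 0 0 + t + q * cnj (N 0 0)" "M t 1 1 = - N 0 0 + t - q * cnj (N 0 0)"
    "M t 0 1 = N 0 1 + q * cnj (N 1 0)" "M t 1 0 = N 1 0 + q * cnj (N 0 1)"
    unfolding M_def fadj_def fid_def q_def [symmetric] by (simp_all add: N11 [simplified])
  have "M t 0 0 * M t 1 1 - M t 0 1 * M t 1 0
      = (t\<^sup>2 - q * w) - (N 0 0 * N 0 0 + N 0 1 * N 1 0)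
        - q\<^sup>2 * (cnj (N 0 0) * cnj (N 0 0) + cnj (N 0 1) * cnj (N 1 0))"
    unfolding M w_def N11 complex_cnj_minus by (simp add: algebra_simps power2_eq_square)
  also have "\<dots> = 0" unfolding d d' qw by simp
  finally have "M t 0 0 * M t 1 1 = M t 0 1 * M t 1 0" by simp
  then obtain P Q where PQ: "\<forall>a<2. \<forall>b<2. M t a b = fprod 1 P Q a b"
    using singular_2x2_factor by blast
  have "in_hull 2 G (fprod 1 P Q)"
    using in_hull_cong [OF hull [of t]] PQ by blast
  moreover have "pairing 2 c (fprod 1 P Q) = pairing 2 c (M t)" for c
    by (rule pairing_cong) (use PQ in auto)
  ultimately show "\<exists>P Q. in_hull 2 G (fprod 1 P Q) \<and> (\<forall>c\<in>C. pairing 2 c (fprod 1 P Q) \<noteq> 0)"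
    using pM by metis
qed

text \<open>Without nilpotents, the determinant has no zero on the traceless part of the system,
  which therefore has dimension at most one.\<close>

lemma qubit_hull_no_nilpotent:
  assumes one: "in_hull 2 G fid"
    and no: "\<And>N. in_hull 2 G N \<Longrightarrow> N 0 0 + N 1 1 = 0 \<Longrightarrow> N 0 0 * N 1 1 = N 0 1 * N 1 0
      \<Longrightarrow> \<forall>a<2. \<forall>b<2. N a b = 0"
  shows "\<exists>B. in_hull 2 G B \<and>
    (\<forall>A. in_hull 2 G A \<longrightarrow> (\<exists>x z. \<forall>a<2. \<forall>b<2. A a b = x * fid a b + z * B a b))"
proof (cases "\<exists>B. in_hull 2 G B \<and> B 0 0 + B 1 1 = 0 \<and> (\<exists>a<2. \<exists>b<2. B a b \<noteq> 0)")
  case True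
  then obtain B where B: "in_hull 2 G B" "B 0 0 + B 1 1 = 0" "\<exists>a<2. \<exists>b<2. B a b \<noteq> 0" by blast
  then have "B 0 0 * B 1 1 \<noteq> B 0 1 * B 1 0" using no [of B] by blast
  then have detB: "B 0 0 * B 1 1 - B 0 1 * B 1 0 \<noteq> 0" by simp
  have "\<exists>x z. \<forall>a<2. \<forall>b<2. A a b = x * fid a b + z * B a b" if A: "in_hull 2 G A" for A
  proof -
    define x where "x = (A 0 0 + A 1 1) / 2"
    define T where "T = (\<lambda>a b. A a b + (- x) * fid a b)"
    \<comment> \<open>\<open>T\<close> is the traceless part of \<open>A\<close>. The polynomial is
      the determinant of \<open>T + z B\<close>, with leading coefficient det B; at a root,
      \<open>T + z B\<close> is traceless and singular, hence zero by assumption.\<close>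
    obtain z where z: "(T 0 0 * T 1 1 - T 0 1 * T 1 0)
        + z * (T 0 0 * B 1 1 + T 1 1 * B 0 0 - T 0 1 * B 1 0 - T 1 0 * B 0 1)
        + z\<^sup>2 * (B 0 0 * B 1 1 - B 0 1 * B 1 0) = 0"
      using quadratic_has_root [OF detB] by blast
    define N where "N = (\<lambda>a b. T a b + z * B a b)"
    have "in_hull 2 G N"
      unfolding N_def T_def by (intro in_hull_add [OF in_hull_add] in_hull_smult A B one)
    moreover have "N 0 0 + N 1 1 = 0"
    proof -
      have "N 0 0 + N 1 1 = (T 0 0 + T 1 1) + z * (B 0 0 + B 1 1)"
        unfolding N_def by (simp add: algebra_simps)
      also have "\<dots> = 0" unfolding B(2) by (simp add: T_def fid_def x_def)
      finally show ?thesis .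
    qed
    moreover have "N 0 0 * N 1 1 = N 0 1 * N 1 0"
    proof -
      have "N 0 0 * N 1 1 - N 0 1 * N 1 0 = (T 0 0 * T 1 1 - T 0 1 * T 1 0)
        + z * (T 0 0 * B 1 1 + T 1 1 * B 0 0 - T 0 1 * B 1 0 - T 1 0 * B 0 1)
        + z\<^sup>2 * (B 0 0 * B 1 1 - B 0 1 * B 1 0)"
        unfolding N_def by (simp only: algebra_simps power2_eq_square)
      then show ?thesis unfolding z by simp
    qed
    ultimately have "\<forall>a<2. \<forall>b<2. N a b = 0" by (rule no)
    then have *: "A a b + - x * fid a b + z * B a b = 0" if "a < 2" "b < 2" for a b
      using that unfolding N_def T_def by blast
    have "A a b = x * fid a b + (- z) * B a b" if "a < 2" "b < 2" for a b
    proof -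
      have "A a b = (A a b + - x * fid a b + z * B a b) + (x * fid a b + (- z) * B a b)" by simp
      then show ?thesis unfolding * [OF that] by simp
    qed
    then show ?thesis by blast
  qed
  then show ?thesis using B(1) by blast
next
  case False
  \<comment> \<open>With no nonzero traceless element every member of the hull is a multiple of the
    identity, which can therefore be taken for \<open>B\<close> as well.\<close>
  have "\<exists>x z. \<forall>a<2. \<forall>b<2. A a b = x * fid a b + z * fid a b" if A: "in_hull 2 G A" for A
  proof -
    define x where "x = (A 0 0 + A 1 1) / 2"
    define T where "T = (\<lambda>a b. A a b + (- x) * fid a b)"
    have "in_hull 2 G T"
      unfolding T_def by (intro in_hull_add in_hull_smult A one)
    moreover have "T 0 0 + T 1 1 = 0" by (simp add: T_def fid_def x_def)
    ultimately have "\<forall>a<2. \<forall>b<2. T a b = 0" using False by blast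
    then have *: "A a b + - x * fid a b = 0" if "a < 2" "b < 2" for a b
      using that unfolding T_def by blast
    have "A a b = x * fid a b + 0 * fid a b" if "a < 2" "b < 2" for a b
      using * [OF that] by (simp add: add_eq_0_iff)
    then show ?thesis by blast
  qed
  then show ?thesis using one by blast
qed

text \<open>With \<open>l\<close> a root of the characteristic polynomial, a nonzero row (p, q) of
  \<open>B - l I\<close> is annihilated by (q, -p), and singularity makes the other row vanish on it
  too. If \<open>B = l I\<close>, any vector works.\<close>

lemma eigenvector_2x2:
  fixes B :: fmat
  obtains v0 v1 l where "v0 \<noteq> 0 \<or> v1 \<noteq> 0"
    "B 0 0 * v0 + B 0 1 * v1 = l * v0" "B 1 0 * v0 + B 1 1 * v1 = l * v1"
proof -
  obtain l where l: "(B 0 0 * B 1 1 - B 0 1 * B 1 0) + l * (- B 0 0 - B 1 1) + l\<^sup>2 * 1 = 0"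
    using quadratic_has_root [of 1] by fastforce
  then have det: "(B 0 0 - l) * (B 1 1 - l) = B 0 1 * B 1 0"
    by (simp add: algebra_simps power2_eq_square)
  show thesis
  proof (cases "B 0 1 = 0 \<and> B 0 0 = l")
    case False
    have "B 1 0 * B 0 1 + B 1 1 * (l - B 0 0) = l * (l - B 0 0)"
      using det by (simp add: algebra_simps)
    then show thesis using False that [of "B 0 1" "l - B 0 0" l] by (auto simp: algebra_simps)
  next
    case True
    show thesis
    proof (cases "B 1 0 = 0 \<and> B 1 1 = l")
      case True
      with \<open>B 0 1 = 0 \<and> B 0 0 = l\<close> show thesis using that [of 1 0 l] by simp
    next
      case False
      with True show thesis using that [of "l - B 1 1" "B 1 0" l] by (auto simp: algebra_simps)
    qed
  qed
qed

text \<open>Take an eigenvector \<open>v\<close> of \<open>B\<close> and \<open>u\<close> orthogonal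
  to it: both <u|v> and <u|B|v> = l <u|v> vanish, hence so does <u|A|v> on the whole hull. Closure
  under adjoints gives the reversed pairing.\<close>

lemma qubit_commutative_independent:
  assumes adj: "\<And>A. in_hull 2 G A \<Longrightarrow> in_hull 2 G (fadj A)"
    and B: "in_hull 2 G B"
    and span: "\<And>A. in_hull 2 G A \<Longrightarrow> \<exists>x z. \<forall>a<2. \<forall>b<2. A a b = x * fid a b + z * B a b"
  shows "\<exists>\<psi>. independent_vectors 2 G 2 \<psi>"
proof -
  obtain v0 v1 l where v: "v0 \<noteq> 0 \<or> v1 \<noteq> 0"
    "B 0 0 * v0 + B 0 1 * v1 = l * v0" "B 1 0 * v0 + B 1 1 * v1 = l * v1"
    by (rule eigenvector_2x2)
  define v where "v = (\<lambda>a::nat. if a = 0 then v0 else v1)"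
  define u where "u = (\<lambda>a::nat. if a = 0 then - cnj v1 else cnj v0)"
  have uv: "pairing 2 (dyad u v) A = 0" if A: "in_hull 2 G A" for A
  proof -
    obtain x z where xz: "\<forall>a<2. \<forall>b<2. A a b = x * fid a b + z * B a b" using span [OF A] by blast
    have "pairing 2 (dyad u v) A = pairing 2 (dyad u v) (\<lambda>a b. x * fid a b + z * B a b)"
      by (rule pairing_cong) (use xz in auto)
    also have "\<dots> = z * (- v1 * (B 0 0 * v0 + B 0 1 * v1) + v0 * (B 1 0 * v0 + B 1 1 * v1))"
      unfolding pairing_add pairing_smult unfolding pairing_2
      by (simp add: dyad_def u_def v_def fid_def algebra_simps)
    also have "\<dots> = 0" unfolding v(2,3) by simp
    finally show ?thesis .
  qed
  have vu: "pairing 2 (dyad v u) A = 0" if A: "in_hull 2 G A" for A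
  proof -
    have "dyad v u = fadj (dyad u v)" by (simp add: dyad_def fadj_def mult.commute)
    then have "pairing 2 (dyad v u) A = cnj (pairing 2 (dyad u v) (fadj A))"
      using pairing_fadj [of 2 "dyad u v" A] by simp
    then show ?thesis using uv [OF adj [OF A]] by simp
  qed
  have "independent_vectors 2 G 2 (\<lambda>s. if s = 0 then u else v)"
    unfolding independent_vectors_def
  proof (intro conjI allI impI ballI)
    fix s :: nat assume "s < 2"
    show "\<exists>a<2. (if s = 0 then u else v) a \<noteq> 0"
      using v(1) unfolding u_def v_def by (cases "v0 = 0"; cases "s = 0"; force)
  next
    fix s t :: nat and g assume "s < 2" "t < 2" "s \<noteq> t" "g \<in> G"
    then show "pairing 2 (dyad (if s = 0 then u else v) (if t = 0 then u else v)) g = 0"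
      using uv vu in_hull_base by (auto dest!: less_2_cases)
  qed
  then show ?thesis by blast
qed

lemma independent_vectors_single:
  assumes "0 < n"
  shows "independent_vectors n G 1 (\<lambda>_ _. 1)"
  using assms by (auto simp: independent_vectors_def)

text \<open>The split is on whether the hull contains a nonzero nilpotent. If so, a single vector
  meets the bound of rank one; if not, two orthogonal vectors meet the bound by the
  dimension.\<close>

lemma qubit_dichotomy:
  assumes one: "in_hull 2 G fid" and adj: "\<And>g. g \<in> G \<Longrightarrow> fadj g \<in> G"
  shows "\<exists>r\<in>{1, 2}. generic_rank 2 G r \<and> (\<exists>\<psi>. independent_vectors 2 G r \<psi>)"
proof (cases "\<exists>N. in_hull 2 G N \<and> N 0 0 + N 1 1 = 0 \<and> N 0 0 * N 1 1 = N 0 1 * N 1 0 \<and>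
    (\<exists>a<2. \<exists>b<2. N a b \<noteq> 0)")
  case True
  then have "generic_rank 2 G 1"
    using generic_rank_qubit_nilpotent [OF one] in_hull_fadj [OF adj] by blast
  moreover have "\<exists>\<psi>. independent_vectors 2 G 1 \<psi>"
    using independent_vectors_single [of 2] by auto
  ultimately show ?thesis by blast
next
  case False
  then have "\<exists>\<psi>. independent_vectors 2 G 2 \<psi>"
    using qubit_hull_no_nilpotent [OF one] qubit_commutative_independent [of G] in_hull_fadj [OF adj]
    by blast
  then show ?thesis using generic_rank_dim [OF one] by blast
qed

section \<open>Kraus operators\<close>

abbreviation funit :: "nat \<Rightarrow> nat \<Rightarrow> complex" where
  "funit k \<equiv> (\<lambda>a. of_bool (a = k))"

lemma pairing_dyad_add_smult:
  "pairing n (dyad (\<lambda>a. u a + c * w a) (\<lambda>a. u a + c * w a)) A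
    = pairing n (dyad u u) A + c * pairing n (dyad u w) A
      + cnj c * pairing n (dyad w u) A + c * cnj c * pairing n (dyad w w) A"
proof -
  have "pairing n (dyad (\<lambda>a. u a + c * w a) (\<lambda>a. u a + c * w a)) A
    = (\<Sum>a<n. \<Sum>b<n. cnj (u a) * u b * A a b + c * (cnj (u a) * w b * A a b)
        + cnj c * (cnj (w a) * u b * A a b) + c * cnj c * (cnj (w a) * w b * A a b))"
    unfolding pairing_def dyad_def by (intro sum.cong refl) (simp add: algebra_simps)
  then show ?thesis
    unfolding pairing_def dyad_def by (simp add: sum.distrib sum_distrib_left)
qed

lemma pairing_dyad_funit_right:
  assumes "k < n"
  shows "pairing n (dyad u (funit k)) A = (\<Sum>a<n. cnj (u a) * A a k)"
  unfolding pairing_def dyad_def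
proof (rule sum.cong [OF refl])
  fix a
  have "(\<Sum>b<n. cnj (u a) * of_bool (b = k) * A a b) = (\<Sum>b<n. if b = k then cnj (u a) * A a k else 0)"
    by (rule sum.cong) auto
  then show "(\<Sum>b<n. cnj (u a) * of_bool (b = k) * A a b) = cnj (u a) * A a k"
    using assms by simp
qed

lemma pairing_dyad_funit_left:
  assumes "k < n"
  shows "pairing n (dyad (funit k) v) A = (\<Sum>b<n. A k b * v b)"
proof -
  have "pairing n (dyad (funit k) v) A = (\<Sum>a<n. if a = k then \<Sum>b<n. A k b * v b else 0)"
    unfolding pairing_def dyad_def by (rule sum.cong) (auto intro!: sum.cong simp: mult.commute)
  then show ?thesis using assms by simp
qed

lemma pairing_dyad_funit:
  assumes "j < n" "k < n"
  shows "pairing n (dyad (funit j) (funit k)) A = A j k"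
proof -
  have "pairing n (dyad (funit j) (funit k)) A = (\<Sum>a<n. if a = j then A j k else 0)"
    unfolding pairing_dyad_funit_right [OF assms(2)] by (rule sum.cong) auto
  then show ?thesis using assms by simp
qed

section \<open>Positive semidefinite matrices as sums of rank-one matrices\<close>

definition fpsd :: "nat \<Rightarrow> fmat \<Rightarrow> bool" where
  "fpsd n A \<longleftrightarrow> (\<forall>v. 0 \<le> pairing n (dyad v v) A)"

text \<open>Polarization: reality of the form at u + v compares the imaginary parts, and at u + i v
  the real parts.\<close>

lemma fpsd_hermitian:
  assumes "fpsd n A"
  shows "pairing n (dyad v u) A = cnj (pairing n (dyad u v) A)"
proof -
  have real: "Im (pairing n (dyad v v) A) = 0" for v
    using assms unfolding fpsd_def less_eq_complex_def by simp
  have "Im (pairing n (dyad u v) A) + Im (pairing n (dyad v u) A) = 0"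
    using real [of "\<lambda>a. u a + 1 * v a"] unfolding pairing_dyad_add_smult by (simp add: real)
  moreover have "Re (pairing n (dyad u v) A) - Re (pairing n (dyad v u) A) = 0"
    using real [of "\<lambda>a. u a + \<i> * v a"] unfolding pairing_dyad_add_smult by (simp add: real)
  ultimately show ?thesis by (simp add: complex_eq_iff)
qed

lemma fpsd_hermitian_entry:
  assumes "fpsd n A" "j < n" "k < n"
  shows "A j k = cnj (A k j)"
  using fpsd_hermitian [OF assms(1), of "funit j" "funit k"] assms by (simp add: pairing_dyad_funit)

lemma fpsd_diag:
  assumes "fpsd n A" "k < n"
  shows "0 \<le> A k k"
  using assms pairing_dyad_funit [OF assms(2) assms(2), of A] unfolding fpsd_def by metis

lemma fpsd_zero_diag:
  assumes A: "fpsd n A" and jk: "j < n" "k < n" and z: "A j j = 0" "A k k = 0"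
  shows "A j k = 0"
proof -
  \<comment> \<open>With both diagonal entries zero, the form at e_j + c e_k is linear in
    \<open>c\<close> and its conjugate; this choice turns it into -2 |A_jk|^2, which positivity
    forces to vanish.\<close>
  define c where "c = - cnj (A j k)"
  have "0 \<le> pairing n (dyad (\<lambda>a. funit j a + c * funit k a) (\<lambda>a. funit j a + c * funit k a)) A"
    using A unfolding fpsd_def by blast
  also have "\<dots> = c * A j k + cnj c * A k j"
    unfolding pairing_dyad_add_smult using jk z by (simp add: pairing_dyad_funit)
  also have "\<dots> = - (2 * of_real ((cmod (A j k))\<^sup>2))"
    unfolding fpsd_hermitian_entry [OF A jk(2,1)] c_def complex_norm_square by (simp add: mult.commute)
  finally show ?thesis unfolding less_eq_complex_def by simp
qed

text \<open>One step of Cholesky elimination: subtracting the rank-one part through the pivot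
  \<open>A\<^sub>k\<^sub>k\<close> preserves positivity, since it only replaces \<open>v\<close> by \<open>v + c e\<^sub>k\<close> for the minimizing \<open>c\<close>.\<close>

lemma fpsd_eliminate:
  assumes A: "fpsd n A" and k: "k < n" and nz: "A k k \<noteq> 0"
  shows "fpsd n (\<lambda>a b. A a b - A a k * A k b / A k k)"
  unfolding fpsd_def
proof
  fix v
  define h where "h = pairing n (dyad (funit k) v) A"
  have h': "pairing n (dyad v (funit k)) A = cnj h"
    unfolding h_def by (rule fpsd_hermitian [OF A])
  have cnj_pivot: "cnj (A k k) = A k k"
    using fpsd_hermitian_entry [OF A k k] by simp
  define c where "c = - h / A k k"
  have "pairing n (dyad v v) (\<lambda>a b. A a b - A a k * A k b / A k k)
      = pairing n (dyad v v) A - (\<Sum>a<n. \<Sum>b<n. (cnj (v a) * A a k) * (A k b * v b)) / A k k"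
    unfolding pairing_def dyad_def sum_divide_distrib sum_subtractf [symmetric]
    by (intro sum.cong refl) (simp add: algebra_simps)
  also have "\<dots> = pairing n (dyad v v) A - cnj h * h / A k k"
    unfolding sum_product [symmetric]
    using h' h_def unfolding pairing_dyad_funit_left [OF k] pairing_dyad_funit_right [OF k] by simp
  also have "\<dots> = pairing n (dyad (\<lambda>a. v a + c * funit k a) (\<lambda>a. v a + c * funit k a)) A"
    unfolding pairing_dyad_add_smult h' h_def [symmetric] pairing_dyad_funit [OF k k]
    using nz by (simp add: c_def cnj_pivot field_simps)
  also have "\<dots> \<ge> 0" using A unfolding fpsd_def by blast
  finally show "0 \<le> pairing n (dyad v v) (\<lambda>a b. A a b - A a k * A k b / A k k)" .
qed

text \<open>Induction on the number of nonzero diagonal entries: one elimination step clears the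
  pivot, creates no new nonzero diagonal entry, and splits off a single rank-one term.\<close>

lemma fpsd_decomposition:
  assumes "fpsd n A"
  shows "\<exists>(p::nat) w. \<forall>a<n. \<forall>b<n. A a b = (\<Sum>x<p. w x a * cnj (w x b))"
  using assms
proof (induction "card {k. k < n \<and> A k k \<noteq> 0}" arbitrary: A rule: less_induct)
  case less
  show ?case
  proof (cases "\<exists>k<n. A k k \<noteq> 0")
    case False
    then have "\<forall>a<n. \<forall>b<n. A a b = 0"
      using fpsd_zero_diag [OF less.prems] by blast
    then show ?thesis by (intro exI [of _ "0::nat"]) auto
  next
    case True
    then obtain k where k: "k < n" "A k k \<noteq> 0" by blast
    define A' where "A' = (\<lambda>a b. A a b - A a k * A k b / A k k)"
    have A': "fpsd n A'"
      unfolding A'_def by (rule fpsd_eliminate [OF less.prems k])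
    define \<alpha> where "\<alpha> = Re (A k k)"
    have \<alpha>: "A k k = of_real \<alpha>" "0 < \<alpha>"
      using fpsd_diag [OF less.prems k(1)] k(2)
      by (auto simp: \<alpha>_def less_eq_complex_def complex_eq_iff)
    \<comment> \<open>Elimination subtracts a nonnegative amount from a zero entry, while positivity
      of \<open>A'\<close> keeps the result nonnegative.\<close>
    have zero: "A' j j = 0" if j: "j < n" "A j j = 0" for j
    proof -
      have "A' j j = - of_real ((cmod (A j k))\<^sup>2 / \<alpha>)"
        unfolding A'_def fpsd_hermitian_entry [OF less.prems k(1) j(1)] of_real_divide
          complex_norm_square using j(2) \<alpha>(1) by simp
      moreover have "0 \<le> A' j j" by (rule fpsd_diag [OF A' j(1)])
      ultimately have "(cmod (A j k))\<^sup>2 / \<alpha> \<le> 0" by (simp add: less_eq_complex_def)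
      then have "(cmod (A j k))\<^sup>2 / \<alpha> = 0" using \<alpha>(2) by (intro order_antisym) auto
      then show ?thesis using \<open>A' j j = - of_real ((cmod (A j k))\<^sup>2 / \<alpha>)\<close> by simp
    qed
    have "A' k k = 0" using k(2) by (simp add: A'_def)
    then have "{j. j < n \<and> A' j j \<noteq> 0} \<subset> {j. j < n \<and> A j j \<noteq> 0}"
      using zero k by auto
    then have "card {j. j < n \<and> A' j j \<noteq> 0} < card {j. j < n \<and> A j j \<noteq> 0}"
      by (rule psubset_card_mono [rotated]) simp
    from less.hyps [OF this A']
    obtain p :: nat and w where w: "\<forall>a<n. \<forall>b<n. A' a b = (\<Sum>x<p. w x a * cnj (w x b))"
      by blast
    \<comment> \<open>The additional vector is the pivot column divided by the square root of the
      pivot, so that its outer product is the part subtracted.\<close>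
    define w' where "w' x a = (if x < p then w x a else A a k / of_real (sqrt \<alpha>))" for x a
    have "A a b = (\<Sum>x<Suc p. w' x a * cnj (w' x b))" if ab: "a < n" "b < n" for a b
    proof -
      have "complex_of_real (sqrt \<alpha>) * of_real (sqrt \<alpha>) = of_real \<alpha>"
        using \<alpha>(2) by (simp flip: of_real_mult)
      then have "w' p a * cnj (w' p b) = A a k * cnj (A b k) / of_real \<alpha>"
        by (simp add: w'_def)
      also have "\<dots> = A a k * A k b / A k k"
        using fpsd_hermitian_entry [OF less.prems k(1) ab(2)] \<alpha>(1) by simp
      finally have last: "w' p a * cnj (w' p b) = A a k * A k b / A k k" .
      have "(\<Sum>x<p. w' x a * cnj (w' x b)) = (\<Sum>x<p. w x a * cnj (w x b))"
        by (rule sum.cong) (simp_all add: w'_def)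
      then have "(\<Sum>x<Suc p. w' x a * cnj (w' x b)) = A' a b + A a k * A k b / A k k"
        using w ab last by simp
      then show ?thesis by (simp add: A'_def)
    qed
    then show ?thesis by blast
  qed
qed

lemma psd_fpsd:
  assumes "psd n A"
  shows "fpsd n (\<lambda>a b. A $$ (a, b))"
  unfolding fpsd_def
proof
  fix v :: "nat \<Rightarrow> complex"
  have A: "A \<in> carrier_mat n n" using assms by (simp add: psd_def)
  have "0 \<le> (A *\<^sub>v vec n v) \<bullet>c vec n v"
    using assms by (simp add: psd_def)
  also have "(A *\<^sub>v vec n v) \<bullet>c vec n v = pairing n (dyad v v) (\<lambda>a b. A $$ (a, b))"
    using A unfolding pairing_def dyad_def
    by (simp add: scalar_prod_def lessThan_atLeast0 sum_distrib_left sum_distrib_right algebra_simps)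
  finally show "0 \<le> pairing n (dyad v v) (\<lambda>a b. A $$ (a, b))" .
qed

text \<open>The Kraus form is stated entrywise, with operators indexed by \<open>x < p\<close>; the
  carrier condition is included because entries alone do not fix the size of the output.\<close>

definition kraus_fun :: "channel \<Rightarrow> nat \<Rightarrow> (nat \<Rightarrow> fmat) \<Rightarrow> bool" where
  "kraus_fun N p E \<longleftrightarrow>
     (\<forall>\<rho> \<in> carrier_mat (in_dim N) (in_dim N).
        chan_map N \<rho> \<in> carrier_mat (out_dim N) (out_dim N) \<and>
        (\<forall>r<out_dim N. \<forall>c<out_dim N. chan_map N \<rho> $$ (r, c) =
           (\<Sum>x<p. \<Sum>a<in_dim N. \<Sum>b<in_dim N. E x r a * \<rho> $$ (a, b) * cnj (E x c b))))"

lemma index_mat_adjoint: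
  assumes "i < dim_col A" "j < dim_row A"
  shows "mat_adjoint A $$ (i, j) = cnj (A $$ (j, i))"
  using assms unfolding mat_adjoint_def by (simp add: mat_of_rows_index)

lemma dim_mat_adjoint [simp]:
  "dim_row (mat_adjoint A) = dim_col A" "dim_col (mat_adjoint A) = dim_row A"
  unfolding mat_adjoint_def by simp_all

lemma index_sandwich:
  assumes "E \<in> carrier_mat n' n" "\<rho> \<in> carrier_mat n n" "r < n'" "c < n'"
  shows "(E * \<rho> * mat_adjoint E) $$ (r, c)
    = (\<Sum>a<n. \<Sum>b<n. E $$ (r, a) * \<rho> $$ (a, b) * cnj (E $$ (c, b)))"
proof -
  have "(E * \<rho> * mat_adjoint E) $$ (r, c)
      = (\<Sum>b<n. (\<Sum>a<n. E $$ (r, a) * \<rho> $$ (a, b)) * cnj (E $$ (c, b)))"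
    using assms by (simp add: scalar_prod_def lessThan_atLeast0 index_mat_adjoint)
  also have "\<dots> = (\<Sum>b<n. \<Sum>a<n. E $$ (r, a) * \<rho> $$ (a, b) * cnj (E $$ (c, b)))"
    by (simp add: sum_distrib_right)
  also have "\<dots> = (\<Sum>a<n. \<Sum>b<n. E $$ (r, a) * \<rho> $$ (a, b) * cnj (E $$ (c, b)))"
    by (rule sum.swap)
  finally show ?thesis .
qed

lemma foldr_mat_add:
  fixes Es :: "'a list" and f :: "'a \<Rightarrow> complex mat"
  assumes "\<And>E. E \<in> set Es \<Longrightarrow> f E \<in> carrier_mat m m'"
  shows "foldr (+) (map f Es) (0\<^sub>m m m') \<in> carrier_mat m m' \<and>
    (\<forall>r<m. \<forall>c<m'. foldr (+) (map f Es) (0\<^sub>m m m') $$ (r, c) = (\<Sum>x<length Es. f (Es ! x) $$ (r, c)))"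
  using assms
proof (induction Es)
  case (Cons E Es)
  let ?F = "foldr (+) (map f Es) (0\<^sub>m m m')"
  have E: "f E \<in> carrier_mat m m'" using Cons.prems by simp
  have F: "?F \<in> carrier_mat m m'"
    and ind: "\<And>r c. r < m \<Longrightarrow> c < m' \<Longrightarrow> ?F $$ (r, c) = (\<Sum>x<length Es. f (Es ! x) $$ (r, c))"
    using Cons by auto
  have "(f E + ?F) $$ (r, c) = (\<Sum>x<length (E # Es). f ((E # Es) ! x) $$ (r, c))"
    if "r < m" "c < m'" for r c
    using that E F ind by (simp add: sum.lessThan_Suc_shift del: sum.lessThan_Suc)
  then show ?case using E F by simp
qed simp

lemma kraus_rep_imp_kraus_fun:
  assumes "kraus_rep N Es"
  shows "kraus_fun N (length Es) (\<lambda>x r a. (Es ! x) $$ (r, a))"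
  unfolding kraus_fun_def
proof (intro ballI)
  fix \<rho> :: "complex mat" assume \<rho>: "\<rho> \<in> carrier_mat (in_dim N) (in_dim N)"
  have Es: "E \<in> carrier_mat (out_dim N) (in_dim N)" if "E \<in> set Es" for E
    using assms that unfolding kraus_rep_def by blast
  have "E * \<rho> * mat_adjoint E \<in> carrier_mat (out_dim N) (out_dim N)" if "E \<in> set Es" for E
    using Es [OF that] \<rho> by (intro mult_carrier_mat [where n = "in_dim N"] carrier_matI) auto
  note fold = foldr_mat_add [of Es "\<lambda>E. E * \<rho> * mat_adjoint E", OF this]
  have "chan_map N \<rho> = foldr (+) (map (\<lambda>E. E * \<rho> * mat_adjoint E) Es) (0\<^sub>m (out_dim N) (out_dim N))"
    using assms \<rho> unfolding kraus_rep_def by blast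
  then show "chan_map N \<rho> \<in> carrier_mat (out_dim N) (out_dim N) \<and>
    (\<forall>r<out_dim N. \<forall>c<out_dim N. chan_map N \<rho> $$ (r, c) =
       (\<Sum>x<length Es. \<Sum>a<in_dim N. \<Sum>b<in_dim N.
          (Es ! x) $$ (r, a) * \<rho> $$ (a, b) * cnj ((Es ! x) $$ (c, b))))"
    using fold index_sandwich [OF Es \<rho>] by simp
qed

lemma kraus_fun_imp_kraus_rep:
  assumes "kraus_fun N p E"
  shows "kraus_rep N (map (\<lambda>x. mat (out_dim N) (in_dim N) (\<lambda>(r, a). E x r a)) [0..<p])"
    (is "kraus_rep N ?Es")
  unfolding kraus_rep_def
proof (intro conjI ballI)
  show Es: "set ?Es \<subseteq> carrier_mat (out_dim N) (in_dim N)" by auto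
  fix \<rho> :: "complex mat" assume \<rho>: "\<rho> \<in> carrier_mat (in_dim N) (in_dim N)"
  have "F * \<rho> * mat_adjoint F \<in> carrier_mat (out_dim N) (out_dim N)" if "F \<in> set ?Es" for F
    using Es that \<rho> by (intro mult_carrier_mat [where n = "in_dim N"] carrier_matI) auto
  note fold = foldr_mat_add [of ?Es "\<lambda>E. E * \<rho> * mat_adjoint E", OF this]
  show "chan_map N \<rho> = foldr (+) (map (\<lambda>E. E * \<rho> * mat_adjoint E) ?Es) (0\<^sub>m (out_dim N) (out_dim N))"
    (is "_ = ?R")
  proof (rule eq_matI)
    fix r c assume "r < dim_row ?R" "c < dim_col ?R"
    then have rc: "r < out_dim N" "c < out_dim N" using fold by auto
    have "?R $$ (r, c) = (\<Sum>x<p. \<Sum>a<in_dim N. \<Sum>b<in_dim N. E x r a * \<rho> $$ (a, b) * cnj (E x c b))"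
      using fold rc index_sandwich [OF _ \<rho> rc, of "mat (out_dim N) (in_dim N) (\<lambda>(r, a). E x r a)" for x]
      by simp
    then show "chan_map N \<rho> $$ (r, c) = ?R $$ (r, c)"
      using assms \<rho> rc unfolding kraus_fun_def by simp
  qed (use fold assms \<rho> in \<open>auto simp: kraus_fun_def\<close>)
qed

section \<open>The Choi matrix and the existence of Kraus operators\<close>

lemma mat_unit_carrier [simp]: "mat_unit n i j \<in> carrier_mat n n"
  by (simp add: mat_unit_def ketbra_def)

lemma index_mat_unit:
  "a < n \<Longrightarrow> b < n \<Longrightarrow> i < n \<Longrightarrow> j < n \<Longrightarrow> mat_unit n i j $$ (a, b) = of_bool (a = i) * of_bool (b = j)"
  by (simp add: mat_unit_def ketbra_def)

lemma linear_channel_expansion: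
  assumes L: "linear_channel N" and \<rho>: "\<rho> \<in> carrier_mat (in_dim N) (in_dim N)"
    and rc: "r < out_dim N" "c < out_dim N"
  shows "chan_map N \<rho> $$ (r, c)
    = (\<Sum>a<in_dim N. \<Sum>b<in_dim N. \<rho> $$ (a, b) * chan_map N (mat_unit (in_dim N) a b) $$ (r, c))"
proof -
  let ?n = "in_dim N"
  \<comment> \<open>Restricting \<rho> to the positions in \<open>S\<close> allows induction over
    finite sets, one matrix unit being added at each step.\<close>
  define part where
    "part S = mat ?n ?n (\<lambda>(a, b). if (a, b) \<in> S then \<rho> $$ (a, b) else 0)" for S
  have carrier: "chan_map N A \<in> carrier_mat (out_dim N) (out_dim N)" if "A \<in> carrier_mat ?n ?n" for A
    using L that unfolding linear_channel_def by blast
  have "chan_map N (part S) $$ (r, c)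
      = (\<Sum>(a, b)\<in>S. \<rho> $$ (a, b) * chan_map N (mat_unit ?n a b) $$ (r, c))"
    if "finite S" "S \<subseteq> {..<?n} \<times> {..<?n}" for S
    using that
  proof (induction S rule: finite_induct)
    case empty
    \<comment> \<open>The zero matrix is 0 times itself, so homogeneity sends it to zero.\<close>
    have "0 \<cdot>\<^sub>m part {} = part {}" by (intro eq_matI) (auto simp: part_def)
    moreover have "chan_map N (0 \<cdot>\<^sub>m part {}) = 0 \<cdot>\<^sub>m chan_map N (part {})"
      using L unfolding linear_channel_def by (simp add: part_def)
    ultimately have "chan_map N (part {}) = 0 \<cdot>\<^sub>m chan_map N (part {})"
      by simp
    then have "chan_map N (part {}) $$ (r, c) = (0 \<cdot>\<^sub>m chan_map N (part {})) $$ (r, c)"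
      by (rule arg_cong)
    also have "\<dots> = 0" using carrier [of "part {}"] rc by (simp add: part_def)
    finally show ?case by simp
  next
    case (insert ab S)
    obtain a b where ab: "ab = (a, b)" by (cases ab)
    then have lt: "a < ?n" "b < ?n" using insert.prems by auto
    have "part (insert ab S) = \<rho> $$ (a, b) \<cdot>\<^sub>m mat_unit ?n a b + part S"
    proof (rule eq_matI)
      fix i j
      assume "i < dim_row (\<rho> $$ (a, b) \<cdot>\<^sub>m mat_unit ?n a b + part S)"
        "j < dim_col (\<rho> $$ (a, b) \<cdot>\<^sub>m mat_unit ?n a b + part S)"
      then have ij: "i < ?n" "j < ?n" by (auto simp: part_def)
      then show "part (insert ab S) $$ (i, j) = (\<rho> $$ (a, b) \<cdot>\<^sub>m mat_unit ?n a b + part S) $$ (i, j)"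
        using insert.hyps(2) ab lt carrier_matD [OF mat_unit_carrier [of ?n a b]]
        by (auto simp: part_def index_mat_unit)
    qed (auto simp: part_def)
    then have "chan_map N (part (insert ab S))
        = \<rho> $$ (a, b) \<cdot>\<^sub>m chan_map N (mat_unit ?n a b) + chan_map N (part S)"
      using L unfolding linear_channel_def by (simp add: part_def)
    then show ?case
      using insert carrier [of "part S"] carrier [OF mat_unit_carrier, of a b] rc ab
      by (simp add: part_def)
  qed
  from this [of "{..<?n} \<times> {..<?n}"]
  have "chan_map N (part ({..<?n} \<times> {..<?n})) $$ (r, c)
      = (\<Sum>a<?n. \<Sum>b<?n. \<rho> $$ (a, b) * chan_map N (mat_unit ?n a b) $$ (r, c))"
    by (simp add: sum.cartesian_product)
  moreover have "part ({..<?n} \<times> {..<?n}) = \<rho>"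
    using \<rho> by (intro eq_matI) (auto simp: part_def)
  ultimately show ?thesis by simp
qed

lemma index_tensor_channel:
  assumes "r < out_dim N * out_dim M" "c < out_dim N * out_dim M"
    and N: "\<And>A. A \<in> carrier_mat (in_dim N) (in_dim N) \<Longrightarrow> chan_map N A \<in> carrier_mat (out_dim N) (out_dim N)"
    and M: "\<And>A. A \<in> carrier_mat (in_dim M) (in_dim M) \<Longrightarrow> chan_map M A \<in> carrier_mat (out_dim M) (out_dim M)"
  shows "chan_map (tensor_channel N M) \<rho> $$ (r, c)
    = (\<Sum>i<in_dim N. \<Sum>j<in_dim N. \<Sum>k<in_dim M. \<Sum>l<in_dim M.
         \<rho> $$ (i * in_dim M + k, j * in_dim M + l) *
         (chan_map N (mat_unit (in_dim N) i j) $$ (r div out_dim M, c div out_dim M)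
          * chan_map M (mat_unit (in_dim M) k l) $$ (r mod out_dim M, c mod out_dim M)))"
proof -
  have "kron (chan_map N (mat_unit (in_dim N) i j)) (chan_map M (mat_unit (in_dim M) k l)) $$ (r, c)
      = chan_map N (mat_unit (in_dim N) i j) $$ (r div out_dim M, c div out_dim M)
          * chan_map M (mat_unit (in_dim M) k l) $$ (r mod out_dim M, c mod out_dim M)" for i j k l
    using assms(1,2) carrier_matD [OF N [OF mat_unit_carrier [of "in_dim N" i j]]]
      carrier_matD [OF M [OF mat_unit_carrier [of "in_dim M" k l]]]
    by (simp add: kron_def)
  then show ?thesis using assms(1,2) by (simp add: tensor_channel_def)
qed

text \<open>\<open>\<Omega>\<close> is the outer product with itself of the sum of all e_i \<otimes>
  e_i, which is supported on the indices with \<open>r div n = r mod n\<close>. Its quadratic form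
  is therefore a squared modulus.\<close>

lemma psd_maximally_entangled:
  fixes n :: nat
  defines "\<Omega> \<equiv> mat (n * n) (n * n) (\<lambda>(r, c). of_bool (r div n = r mod n) * of_bool (c div n = c mod n))"
  shows "psd (n * n) \<Omega>"
  unfolding psd_def
proof (intro conjI ballI)
  show "\<Omega> \<in> carrier_mat (n * n) (n * n)" by (simp add: \<Omega>_def)
  fix v :: "complex vec" assume v: "v \<in> carrier_vec (n * n)"
  define z where "z = (\<Sum>c<n * n. of_bool (c div n = c mod n) * v $ c)"
  have "(\<Omega> *\<^sub>v v) \<bullet>c v
      = (\<Sum>r<n * n. (\<Sum>c<n * n. of_bool (r div n = r mod n) * of_bool (c div n = c mod n) * v $ c) * cnj (v $ r))"
    using v unfolding \<Omega>_def by (simp add: scalar_prod_def lessThan_atLeast0)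
  also have "\<dots> = (\<Sum>r<n * n. z * cnj (of_bool (r div n = r mod n) * v $ r))"
    unfolding z_def by (intro sum.cong refl) (simp add: sum_distrib_left mult.assoc)
  also have "\<dots> = z * cnj z"
    unfolding z_def cnj_sum by (simp add: sum_distrib_left)
  also have "\<dots> \<ge> 0"
    unfolding complex_norm_square [symmetric] by (simp add: less_eq_complex_def)
  finally show "0 \<le> (\<Omega> *\<^sub>v v) \<bullet>c v" .
qed

text \<open>The blocks of the Choi matrix \<open>J\<close> are the images of the matrix units. Since
  \<open>J\<close> is positive it is a sum of outer products of vectors, and each of these vectors,
  cut into blocks that become columns, is a Kraus operator.\<close>

lemma choi:
  assumes L: "linear_channel N" and CP: "completely_positive N"
  shows "\<exists>p E. kraus_fun N p E"
proof -
  let ?n = "in_dim N" and ?m = "out_dim N"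
  define \<Omega> :: "complex mat" where
    "\<Omega> = mat (?n * ?n) (?n * ?n) (\<lambda>(r, c). of_bool (r div ?n = r mod ?n) * of_bool (c div ?n = c mod ?n))"
  define J where "J = chan_map (tensor_channel (id_channel ?n) N) \<Omega>"
  have "psd (?n * ?m) J"
    using CP psd_maximally_entangled [of ?n] unfolding completely_positive_def J_def \<Omega>_def by blast
  from fpsd_decomposition [OF psd_fpsd [OF this]]
  obtain p :: nat and w where w: "\<forall>r<?n * ?m. \<forall>c<?n * ?m. J $$ (r, c) = (\<Sum>x<p. w x r * cnj (w x c))"
    by blast
  have carrier: "chan_map N A \<in> carrier_mat ?m ?m" if "A \<in> carrier_mat ?n ?n" for A
    using L that unfolding linear_channel_def by blast
  have J: "J $$ (a * ?m + r, b * ?m + c) = chan_map N (mat_unit ?n a b) $$ (r, c)"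
    if ab: "a < ?n" "b < ?n" and rc: "r < ?m" "c < ?m" for a b r c
  proof -
    have "J $$ (a * ?m + r, b * ?m + c)
        = (\<Sum>i<?n. \<Sum>j<?n. \<Sum>k<?n. \<Sum>l<?n. \<Omega> $$ (i * ?n + k, j * ?n + l) *
           (mat_unit ?n i j $$ (a, b) * chan_map N (mat_unit ?n k l) $$ (r, c)))"
      using index_tensor_channel [of "a * ?m + r" "id_channel ?n" N "b * ?m + c" \<Omega>]
        mult_add_less_mult ab rc carrier unfolding J_def by (simp add: id_channel_def)
    \<comment> \<open>The tests are nested from the innermost summation index outwards, so that
      simplification collapses one sum at a time.\<close>
    also have "\<dots> = (\<Sum>i<?n. \<Sum>j<?n. \<Sum>k<?n. \<Sum>l<?n.
        if l = j then (if k = i then (if j = b then (if i = a then chan_map N (mat_unit ?n a b) $$ (r, c) else 0) else 0) else 0) else 0)"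
      using ab by (intro sum.cong refl) (auto simp: \<Omega>_def mult_add_less_mult index_mat_unit)
    also have "\<dots> = chan_map N (mat_unit ?n a b) $$ (r, c)"
      using ab by simp
    finally show ?thesis .
  qed
  have "kraus_fun N p (\<lambda>x r a. w x (a * ?m + r))"
    unfolding kraus_fun_def
  proof (intro ballI conjI allI impI)
    fix \<rho> :: "complex mat" assume \<rho>: "\<rho> \<in> carrier_mat ?n ?n"
    then show "chan_map N \<rho> \<in> carrier_mat ?m ?m" by (rule carrier)
    fix r c assume rc: "r < ?m" "c < ?m"
    have "chan_map N \<rho> $$ (r, c) = (\<Sum>a<?n. \<Sum>b<?n. \<rho> $$ (a, b) * J $$ (a * ?m + r, b * ?m + c))"
      unfolding linear_channel_expansion [OF L \<rho> rc]
      by (intro sum.cong refl) (simp add: J rc)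
    also have "\<dots> = (\<Sum>a<?n. \<Sum>b<?n. \<Sum>x<p. w x (a * ?m + r) * \<rho> $$ (a, b) * cnj (w x (b * ?m + c)))"
      using w mult_add_less_mult rc by (intro sum.cong refl) (simp add: sum_distrib_left algebra_simps)
    also have "\<dots> = (\<Sum>a<?n. \<Sum>x<p. \<Sum>b<?n. w x (a * ?m + r) * \<rho> $$ (a, b) * cnj (w x (b * ?m + c)))"
      by (rule sum.cong [OF refl], rule sum.swap)
    also have "\<dots> = (\<Sum>x<p. \<Sum>a<?n. \<Sum>b<?n. w x (a * ?m + r) * \<rho> $$ (a, b) * cnj (w x (b * ?m + c)))"
      by (rule sum.swap)
    finally show "chan_map N \<rho> $$ (r, c)
      = (\<Sum>x<p. \<Sum>a<?n. \<Sum>b<?n. w x (a * ?m + r) * \<rho> $$ (a, b) * cnj (w x (b * ?m + c)))" .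
  qed
  then show ?thesis by blast
qed

section \<open>The noncommutative graph\<close>

text \<open>The entries of E_x^\<dagger> E_y, the products that span the noncommutative
  graph.\<close>

definition gram :: "nat \<Rightarrow> (nat \<Rightarrow> fmat) \<Rightarrow> nat \<Rightarrow> nat \<Rightarrow> fmat" where
  "gram m E x y = (\<lambda>a b. \<Sum>r<m. cnj (E x r a) * E y r b)"

definition grams :: "nat \<Rightarrow> nat \<Rightarrow> (nat \<Rightarrow> fmat) \<Rightarrow> fmat set" where
  "grams m p E = {gram m E x y | x y. x < p \<and> y < p}"

lemma ball_grams: "(\<forall>g\<in>grams m p E. P g) \<longleftrightarrow> (\<forall>x<p. \<forall>y<p. P (gram m E x y))"
  unfolding grams_def by blast

lemma pairing_dyad_gram:
  "pairing n (dyad s t) (gram m E x y)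
    = (\<Sum>r<m. cnj (\<Sum>a<n. E x r a * s a) * (\<Sum>b<n. E y r b * t b))"
proof -
  have "pairing n (dyad s t) (gram m E x y)
      = (\<Sum>a<n. \<Sum>b<n. \<Sum>r<m. cnj (E x r a * s a) * (E y r b * t b))"
    unfolding pairing_def dyad_def gram_def by (simp add: sum_distrib_left algebra_simps)
  also have "\<dots> = (\<Sum>a<n. \<Sum>r<m. \<Sum>b<n. cnj (E x r a * s a) * (E y r b * t b))"
    by (rule sum.cong [OF refl], rule sum.swap)
  also have "\<dots> = (\<Sum>r<m. \<Sum>a<n. \<Sum>b<n. cnj (E x r a * s a) * (E y r b * t b))"
    by (rule sum.swap)
  also have "\<dots> = (\<Sum>r<m. cnj (\<Sum>a<n. E x r a * s a) * (\<Sum>b<n. E y r b * t b))"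
    by (simp add: sum_product)
  finally show ?thesis .
qed

text \<open>\<open>Tr (\<N>(|s\<rangle>\<langle>s|) \<N>(|t\<rangle>\<langle>t|)) = \<Sum> |\<langle>s|E\<^sub>x\<^sup>\<dagger> E\<^sub>y|t\<rangle>|\<^sup>2\<close>. The left-hand side does not
  mention the Kraus operators, so orthogonality to the graph does not depend on their choice.\<close>

lemma sum_gram_square:
  assumes K: "kraus_fun N p E"
  defines "n \<equiv> in_dim N" and "m \<equiv> out_dim N"
  defines "out v \<equiv> chan_map N (mat n n (\<lambda>(a, b). v a * cnj (v b)))"
  shows "(\<Sum>r<m. \<Sum>c<m. out s $$ (c, r) * out t $$ (r, c))
    = of_real (\<Sum>x<p. \<Sum>y<p. (cmod (pairing n (dyad s t) (gram m E x y)))\<^sup>2)"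
proof -
  define ev where "ev v x r = (\<Sum>a<n. E x r a * v a)" for v x r
  have out: "out v $$ (r, c) = (\<Sum>x<p. ev v x r * cnj (ev v x c))" if "r < m" "c < m" for v r c
  proof -
    have "out v $$ (r, c) = (\<Sum>x<p. \<Sum>a<n. \<Sum>b<n. E x r a * (v a * cnj (v b)) * cnj (E x c b))"
      using K that unfolding kraus_fun_def out_def n_def m_def by simp
    also have "\<dots> = (\<Sum>x<p. ev v x r * cnj (ev v x c))"
      unfolding ev_def cnj_sum sum_product by (intro sum.cong refl) (simp add: algebra_simps)
    finally show ?thesis .
  qed
  have "(\<Sum>r<m. \<Sum>c<m. out s $$ (c, r) * out t $$ (r, c))
      = (\<Sum>r<m. \<Sum>c<m. \<Sum>x<p. \<Sum>y<p.
          (cnj (ev s x r) * ev t y r) * cnj (cnj (ev s x c) * ev t y c))"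
    by (intro sum.cong refl) (simp add: out sum_product algebra_simps)
  also have "\<dots> = (\<Sum>r<m. \<Sum>x<p. \<Sum>c<m. \<Sum>y<p.
          (cnj (ev s x r) * ev t y r) * cnj (cnj (ev s x c) * ev t y c))"
    by (rule sum.cong [OF refl], rule sum.swap)
  also have "\<dots> = (\<Sum>r<m. \<Sum>x<p. \<Sum>y<p. \<Sum>c<m.
          (cnj (ev s x r) * ev t y r) * cnj (cnj (ev s x c) * ev t y c))"
    by (rule sum.cong [OF refl], rule sum.cong [OF refl], rule sum.swap)
  also have "\<dots> = (\<Sum>x<p. \<Sum>r<m. \<Sum>y<p. \<Sum>c<m.
          (cnj (ev s x r) * ev t y r) * cnj (cnj (ev s x c) * ev t y c))"
    by (rule sum.swap)
  also have "\<dots> = (\<Sum>x<p. \<Sum>y<p. \<Sum>r<m. \<Sum>c<m.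
          (cnj (ev s x r) * ev t y r) * cnj (cnj (ev s x c) * ev t y c))"
    by (rule sum.cong [OF refl], rule sum.swap)
  also have "\<dots> = (\<Sum>x<p. \<Sum>y<p. pairing n (dyad s t) (gram m E x y) * cnj (pairing n (dyad s t) (gram m E x y)))"
    unfolding pairing_dyad_gram ev_def [symmetric] cnj_sum sum_product ..
  finally show ?thesis
    unfolding complex_norm_square [symmetric] by simp
qed

lemma grams_orthogonal_iff:
  assumes "kraus_fun N p E"
  shows "(\<forall>g\<in>grams (out_dim N) p E. pairing (in_dim N) (dyad s t) g = 0) \<longleftrightarrow>
    (\<Sum>r<out_dim N. \<Sum>c<out_dim N.
       chan_map N (mat (in_dim N) (in_dim N) (\<lambda>(a, b). s a * cnj (s b))) $$ (c, r) *
       chan_map N (mat (in_dim N) (in_dim N) (\<lambda>(a, b). t a * cnj (t b))) $$ (r, c)) = 0"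
  unfolding ball_grams sum_gram_square [OF assms] of_real_eq_0_iff
  by (subst sum_nonneg_eq_0_iff; (intro sum_nonneg)?; simp?)+ (auto simp: sum_nonneg_eq_0_iff)

section \<open>From Hilbert-Schmidt orthogonality to pairings with generators\<close>

lemma hs_inner_eq:
  assumes "X \<in> carrier_mat n n" "Y \<in> carrier_mat n n"
  shows "hs_inner X Y = pairing n (\<lambda>a b. cnj (X $$ (a, b))) (\<lambda>a b. Y $$ (a, b))"
proof -
  have "hs_inner X Y = (\<Sum>b<n. \<Sum>a<n. cnj (X $$ (a, b)) * Y $$ (a, b))"
    using assms unfolding hs_inner_def mat_trace_def
    by (simp add: scalar_prod_def lessThan_atLeast0 index_mat_adjoint)
  also have "\<dots> = pairing n (\<lambda>a b. cnj (X $$ (a, b))) (\<lambda>a b. Y $$ (a, b))"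
    unfolding pairing_def by (rule sum.swap)
  finally show ?thesis .
qed

text \<open>The matrices orthogonal to \<open>X\<close> form a submodule, which contains the span
  once it contains \<open>S\<close>.\<close>

lemma hs_orthogonal_span:
  assumes X: "X \<in> carrier_mat n n" and S: "S \<subseteq> carrier_mat n n"
  shows "hs_orthogonal X (LinearCombinations.module.span class_ring (module_mat TYPE(complex) n n) S)
    \<longleftrightarrow> (\<forall>Y\<in>S. hs_inner X Y = 0)"
proof
  interpret matrix_vs n n "TYPE(complex)" .
  assume "hs_orthogonal X (LinearCombinations.module.span class_ring (module_mat TYPE(complex) n n) S)"
  then show "\<forall>Y\<in>S. hs_inner X Y = 0"
    using in_own_span S unfolding hs_orthogonal_def by blast
next
  interpret matrix_vs n n "TYPE(complex)" .
  assume *: "\<forall>Y\<in>S. hs_inner X Y = 0"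
  let ?K = "{Y \<in> carrier_mat n n. hs_inner X Y = 0}"
  have "submodule class_ring ?K (module_mat TYPE(complex) n n)"
  proof (rule submodule.intro)
    show "Module.module class_ring (module_mat TYPE(complex) n n)"
      using matrix_vs [of n n] unfolding vectorspace_def by blast
    fix A B assume AB: "A \<in> ?K" "B \<in> ?K"
    have "hs_inner X (A + B) = hs_inner X A + hs_inner X B"
    proof -
      have "hs_inner X (A + B) = pairing n (\<lambda>a b. cnj (X $$ (a, b))) (\<lambda>a b. A $$ (a, b) + B $$ (a, b))"
        using AB X by (subst hs_inner_eq [of _ n]) (auto intro!: pairing_cong)
      then show ?thesis
        using AB hs_inner_eq [OF X, of A] hs_inner_eq [OF X, of B] by (simp add: pairing_add)
    qed
    then show "A \<oplus>\<^bsub>module_mat TYPE(complex) n n\<^esub> B \<in> ?K"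
      using AB by (simp add: module_mat_simps)
  next
    fix c :: complex and A assume A: "A \<in> ?K"
    have "hs_inner X (c \<cdot>\<^sub>m A) = c * hs_inner X A"
    proof -
      have "hs_inner X (c \<cdot>\<^sub>m A) = pairing n (\<lambda>a b. cnj (X $$ (a, b))) (\<lambda>a b. c * A $$ (a, b))"
        using A X by (subst hs_inner_eq [of _ n]) (auto intro!: pairing_cong)
      then show ?thesis using A hs_inner_eq [OF X, of A] by (simp add: pairing_smult)
    qed
    then show "c \<odot>\<^bsub>module_mat TYPE(complex) n n\<^esub> A \<in> ?K"
      using A by (simp add: module_mat_simps)
  next
    have "hs_inner X (0\<^sub>m n n) = 0"
      using X by (simp add: hs_inner_eq [of _ n] pairing_def)
    then show "\<zero>\<^bsub>module_mat TYPE(complex) n n\<^esub> \<in> ?K"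
      by (simp add: module_mat_simps)
  qed (simp add: module_mat_simps)
  then have "LinearCombinations.module.span class_ring (module_mat TYPE(complex) n n) S \<subseteq> ?K"
    using * S by (intro span_is_subset) auto
  then show "hs_orthogonal X (LinearCombinations.module.span class_ring (module_mat TYPE(complex) n n) S)"
    unfolding hs_orthogonal_def by blast
qed

text \<open>\<open>nc_graph\<close> rests on a Kraus family picked by choice. Orthogonality for that
  family and for \<open>E\<close> are both equivalent to one condition on the channel outputs, which
  transfers the statement to \<open>E\<close>.\<close>

lemma hs_orthogonal_nc_graph_iff:
  assumes K: "kraus_fun N p E" and s: "s \<in> carrier_vec (in_dim N)" and t: "t \<in> carrier_vec (in_dim N)"
  shows "hs_orthogonal (ketbra s t) (nc_graph N) \<longleftrightarrow>
    (\<forall>g\<in>grams (out_dim N) p E. pairing (in_dim N) (dyad (($) s) (($) t)) g = 0)"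
proof -
  let ?n = "in_dim N" and ?m = "out_dim N"
  define Es where "Es = (SOME Es. kraus_rep N Es)"
  have Es: "kraus_rep N Es"
    unfolding Es_def using kraus_fun_imp_kraus_rep [OF K] by (rule someI)
  then have carrier: "F \<in> carrier_mat ?m ?n" if "F \<in> set Es" for F
    using that unfolding kraus_rep_def by blast
  have X: "ketbra s t \<in> carrier_mat ?n ?n" using s t by (simp add: ketbra_def)
  have prod: "mat_adjoint F * F' \<in> carrier_mat ?n ?n" if "F \<in> set Es" "F' \<in> set Es" for F F'
    using carrier [OF that(1)] carrier [OF that(2)] by (intro carrier_matI) auto
  have inner: "hs_inner (ketbra s t) (mat_adjoint (Es ! x) * (Es ! y))
      = pairing ?n (dyad (($) s) (($) t)) (gram ?m (\<lambda>x r a. (Es ! x) $$ (r, a)) x y)"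
    if "x < length Es" "y < length Es" for x y
  proof -
    have "hs_inner (ketbra s t) (mat_adjoint (Es ! x) * (Es ! y))
        = pairing ?n (\<lambda>a b. cnj (ketbra s t $$ (a, b))) (\<lambda>a b. (mat_adjoint (Es ! x) * (Es ! y)) $$ (a, b))"
      using X prod that by (intro hs_inner_eq) auto
    also have "\<dots> = pairing ?n (dyad (($) s) (($) t)) (gram ?m (\<lambda>x r a. (Es ! x) $$ (r, a)) x y)"
      unfolding pairing_def dyad_def gram_def
      using s t carrier [OF nth_mem [OF that(1)]] carrier [OF nth_mem [OF that(2)]]
      by (intro sum.cong refl arg_cong2 [where f = "(*)"])
        (auto simp: ketbra_def scalar_prod_def lessThan_atLeast0 index_mat_adjoint)
    finally show ?thesis .
  qed
  have "hs_orthogonal (ketbra s t) (nc_graph N) \<longleftrightarrow>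
      (\<forall>Y\<in>{mat_adjoint F * F' | F F'. F \<in> set Es \<and> F' \<in> set Es}. hs_inner (ketbra s t) Y = 0)"
    unfolding nc_graph_def Let_def Es_def [symmetric]
    by (rule hs_orthogonal_span [OF X]) (use prod in auto)
  also have "\<dots> \<longleftrightarrow> (\<forall>x<length Es. \<forall>y<length Es. hs_inner (ketbra s t) (mat_adjoint (Es ! x) * (Es ! y)) = 0)"
    by (auto simp: in_set_conv_nth)
  also have "\<dots> \<longleftrightarrow> (\<forall>g\<in>grams ?m (length Es) (\<lambda>x r a. (Es ! x) $$ (r, a)).
      pairing ?n (dyad (($) s) (($) t)) g = 0)"
    unfolding ball_grams using inner by simp
  also have "\<dots> \<longleftrightarrow> (\<forall>g\<in>grams ?m p E. pairing ?n (dyad (($) s) (($) t)) g = 0)"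
    unfolding grams_orthogonal_iff [OF kraus_rep_imp_kraus_fun [OF Es]] grams_orthogonal_iff [OF K] ..
  finally show ?thesis .
qed

text \<open>The rank bound also makes the set of admissible sizes finite, as \<open>Max\<close>
  requires; the given vectors show that \<open>r\<close> is attained.\<close>

lemma independence_number_eq:
  assumes K: "kraus_fun N p E"
    and R: "generic_rank (in_dim N) (grams (out_dim N) p E) r"
    and I: "independent_vectors (in_dim N) (grams (out_dim N) p E) r \<psi>"
  shows "independence_number N = r"
proof -
  let ?n = "in_dim N" and ?G = "grams (out_dim N) p E"
  let ?S = "{m. \<exists>\<psi> :: nat \<Rightarrow> complex vec.
            (\<forall>s<m. \<psi> s \<in> carrier_vec (in_dim N) \<and> \<psi> s \<noteq> 0\<^sub>v (in_dim N)) \<and>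
            (\<forall>s<m. \<forall>t<m. s \<noteq> t \<longrightarrow> hs_orthogonal (ketbra (\<psi> s) (\<psi> t)) (nc_graph N))}"
  have le: "m \<le> r" if m: "m \<in> ?S" for m
  proof -
    from m obtain \<phi> :: "nat \<Rightarrow> complex vec" where \<phi>: "\<And>s. s < m \<Longrightarrow> \<phi> s \<in> carrier_vec ?n"
      "\<And>s. s < m \<Longrightarrow> \<phi> s \<noteq> 0\<^sub>v ?n"
      "\<And>s t. s < m \<Longrightarrow> t < m \<Longrightarrow> s \<noteq> t \<Longrightarrow> hs_orthogonal (ketbra (\<phi> s) (\<phi> t)) (nc_graph N)"
      by blast
    have "\<exists>a<?n. \<phi> s $ a \<noteq> 0" if "s < m" for s
      using \<phi>(1,2) [OF that] by (auto simp: vec_eq_iff)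
    moreover have "\<forall>g\<in>?G. pairing ?n (dyad (($) (\<phi> s)) (($) (\<phi> t))) g = 0"
      if "s < m" "t < m" "s \<noteq> t" for s t
      using \<phi>(3) [OF that] hs_orthogonal_nc_graph_iff [OF K \<phi>(1) \<phi>(1), OF that(1,2)] by blast
    ultimately have "independent_vectors ?n ?G m (\<lambda>s. ($) (\<phi> s))"
      unfolding independent_vectors_def by blast
    then show ?thesis by (rule independent_vectors_le [OF R])
  qed
  have "r \<in> ?S"
  proof -
    define \<phi> where "\<phi> s = vec ?n (\<psi> s)" for s
    have "\<phi> s \<in> carrier_vec ?n" for s by (simp add: \<phi>_def)
    moreover have "\<phi> s \<noteq> 0\<^sub>v ?n" if s: "s < r" for s
    proof -
      obtain a where "a < ?n" "\<psi> s a \<noteq> 0"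
        using I s unfolding independent_vectors_def by blast
      then have "\<phi> s $ a \<noteq> 0\<^sub>v ?n $ a" by (simp add: \<phi>_def)
      then show ?thesis by metis
    qed
    moreover have "hs_orthogonal (ketbra (\<phi> s) (\<phi> t)) (nc_graph N)"
      if "s < r" "t < r" "s \<noteq> t" for s t
    proof -
      have "pairing ?n (dyad (($) (\<phi> s)) (($) (\<phi> t))) g = pairing ?n (dyad (\<psi> s) (\<psi> t)) g" for g
        unfolding pairing_def dyad_def \<phi>_def by (intro sum.cong refl) auto
      then show ?thesis
        using I that hs_orthogonal_nc_graph_iff [OF K \<open>\<phi> s \<in> carrier_vec ?n\<close> \<open>\<phi> t \<in> carrier_vec ?n\<close>]
        unfolding independent_vectors_def by simp
    qed
    ultimately show ?thesis by blast
  qed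
  moreover have "finite ?S"
    using le by (meson atMost_iff finite_atMost finite_subset subsetI)
  ultimately show ?thesis
    unfolding independence_number_def using le by (intro Max_eqI) auto
qed

section \<open>Channels with matching upper and lower bounds\<close>

text \<open>An upper and a lower bound on the independence number that coincide, each in a form that
  multiplies under tensor products.\<close>

definition exact_channel :: "channel \<Rightarrow> nat \<Rightarrow> bool" where
  "exact_channel N r \<longleftrightarrow> (\<exists>p E. kraus_fun N p E \<and>
     generic_rank (in_dim N) (grams (out_dim N) p E) r \<and>
     (\<exists>\<psi>. independent_vectors (in_dim N) (grams (out_dim N) p E) r \<psi>))"

text \<open>The operators E_x \<otimes> F_y, the pair being coded as \<open>z = x * q + y\<close> in
  the same way as the basis vectors.\<close>

definition kraus_tensor :: "nat \<Rightarrow> nat \<Rightarrow> nat \<Rightarrow> (nat \<Rightarrow> fmat) \<Rightarrow> (nat \<Rightarrow> fmat) \<Rightarrow> nat \<Rightarrow> fmat" where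
  "kraus_tensor q m' m E F =
     (\<lambda>z r a. E (z div q) (r div m') (a div m) * F (z mod q) (r mod m') (a mod m))"

lemma kraus_fun_mat_unit:
  assumes K: "kraus_fun N p E" and rc: "r < out_dim N" "c < out_dim N"
    and ij: "i < in_dim N" "j < in_dim N"
  shows "chan_map N (mat_unit (in_dim N) i j) $$ (r, c) = (\<Sum>x<p. E x r i * cnj (E x c j))"
proof -
  let ?n = "in_dim N"
  have "chan_map N (mat_unit ?n i j) $$ (r, c)
      = (\<Sum>x<p. \<Sum>a<?n. \<Sum>b<?n. E x r a * mat_unit ?n i j $$ (a, b) * cnj (E x c b))"
    using K rc mat_unit_carrier unfolding kraus_fun_def by blast
  also have "\<dots> = (\<Sum>x<p. \<Sum>a<?n. \<Sum>b<?n. if b = j then (if a = i then E x r i * cnj (E x c j) else 0) else 0)"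
    using ij by (intro sum.cong refl) (auto simp: index_mat_unit)
  also have "\<dots> = (\<Sum>x<p. E x r i * cnj (E x c j))"
    using ij by simp
  finally show ?thesis .
qed

text \<open>The factor 1 puts the right-hand side into the shape that \<open>pairing_sum\<close>
  rewrites.\<close>

lemma fkron_sum:
  fixes U V :: "nat \<Rightarrow> fmat"
  shows "fkron m (\<lambda>a b. \<Sum>x<p. U x a b) (\<lambda>a b. \<Sum>y<q. V y a b)
    = (\<lambda>a b. \<Sum>z<p * q. 1 * fkron m (U (z div q)) (V (z mod q)) a b)"
proof (intro ext)
  fix a b
  show "fkron m (\<lambda>a b. \<Sum>x<p. U x a b) (\<lambda>a b. \<Sum>y<q. V y a b) a b
      = (\<Sum>z<p * q. 1 * fkron m (U (z div q)) (V (z mod q)) a b)"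
    using sum_lessThan_mult_div_mod
      [where g = "\<lambda>x y. U x (a div m) (b div m) * V y (a mod m) (b mod m)" and n = p and m = q]
    by (simp add: fkron_def sum_product)
qed

text \<open>Each output entry is a pairing of \<rho> with a Kronecker product of two Kraus sums;
  bilinearity merges them into one sum over coded pairs.\<close>

lemma kraus_fun_tensor:
  assumes K: "kraus_fun N p E" and K': "kraus_fun M q F"
  shows "kraus_fun (tensor_channel N M) (p * q) (kraus_tensor q (out_dim M) (in_dim M) E F)"
  unfolding kraus_fun_def
proof (intro ballI conjI allI impI)
  let ?n = "in_dim N" and ?m = "in_dim M" and ?n' = "out_dim N" and ?m' = "out_dim M"
  fix \<rho> :: "complex mat"
  show "chan_map (tensor_channel N M) \<rho>
      \<in> carrier_mat (out_dim (tensor_channel N M)) (out_dim (tensor_channel N M))"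
    by (simp add: tensor_channel_def)
  fix r c assume "r < out_dim (tensor_channel N M)" "c < out_dim (tensor_channel N M)"
  then have rc: "r < ?n' * ?m'" "c < ?n' * ?m'" by (simp_all add: tensor_channel_def)
  then have "0 < ?m'" by (metis mult_0_right not_less_zero neq0_conv)
  then have rcm: "r div ?m' < ?n'" "c div ?m' < ?n'" "r mod ?m' < ?m'" "c mod ?m' < ?m'"
    using rc by (simp_all add: less_mult_imp_div_less)
  define U where "U x i j = E x (r div ?m') i * cnj (E x (c div ?m') j)" for x i j
  define V where "V y k l = F y (r mod ?m') k * cnj (F y (c mod ?m') l)" for y k l
  have expand: "(\<Sum>i<?n. \<Sum>j<?n. \<Sum>k<?m. \<Sum>l<?m. \<rho> $$ (i * ?m + k, j * ?m + l) * (u i j * v k l))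
      = pairing (?n * ?m) (\<lambda>a b. \<rho> $$ (a, b)) (fkron ?m u v)" for u v
    unfolding pairing_fkron unfolding pairing_def
    by (simp add: sum_distrib_left sum_distrib_right algebra_simps)
  have "chan_map (tensor_channel N M) \<rho> $$ (r, c)
      = (\<Sum>i<?n. \<Sum>j<?n. \<Sum>k<?m. \<Sum>l<?m. \<rho> $$ (i * ?m + k, j * ?m + l) *
          ((\<Sum>x<p. U x i j) * (\<Sum>y<q. V y k l)))"
    using K K' rc unfolding U_def V_def
    by (subst index_tensor_channel) (auto simp: kraus_fun_def [of N] kraus_fun_def [of M]
        kraus_fun_mat_unit [OF K rcm(1,2)] kraus_fun_mat_unit [OF K' rcm(3,4)] intro!: sum.cong)
  also have "\<dots> = pairing (?n * ?m) (\<lambda>a b. \<rho> $$ (a, b))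
      (fkron ?m (\<lambda>a b. \<Sum>x<p. U x a b) (\<lambda>a b. \<Sum>y<q. V y a b))"
    by (rule expand)
  also have "\<dots> = (\<Sum>z<p * q. pairing (?n * ?m) (\<lambda>a b. \<rho> $$ (a, b)) (fkron ?m (U (z div q)) (V (z mod q))))"
    unfolding fkron_sum pairing_sum by simp
  also have "\<dots> = (\<Sum>z<p * q. \<Sum>a<in_dim (tensor_channel N M). \<Sum>b<in_dim (tensor_channel N M).
      kraus_tensor q ?m' ?m E F z r a * \<rho> $$ (a, b) * cnj (kraus_tensor q ?m' ?m E F z c b))"
    unfolding pairing_def fkron_def kraus_tensor_def U_def V_def
    by (simp add: tensor_channel_def algebra_simps)
  finally show "chan_map (tensor_channel N M) \<rho> $$ (r, c)
      = (\<Sum>z<p * q. \<Sum>a<in_dim (tensor_channel N M). \<Sum>b<in_dim (tensor_channel N M).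
      kraus_tensor q ?m' ?m E F z r a * \<rho> $$ (a, b) * cnj (kraus_tensor q ?m' ?m E F z c b))" .
qed

lemma gram_kraus_tensor:
  "gram (n' * m') (kraus_tensor q m' m E F) z w
    = fkron m (gram n' E (z div q) (w div q)) (gram m' F (z mod q) (w mod q))"
proof (intro ext)
  fix a b
  have "gram (n' * m') (kraus_tensor q m' m E F) z w a b
      = (\<Sum>i<n'. \<Sum>k<m'. (cnj (E (z div q) i (a div m)) * E (w div q) i (b div m)) *
          (cnj (F (z mod q) k (a mod m)) * F (w mod q) k (b mod m)))"
    unfolding gram_def kraus_tensor_def sum_lessThan_mult
    by (intro sum.cong refl) (simp add: algebra_simps)
  then show "gram (n' * m') (kraus_tensor q m' m E F) z w a b
      = fkron m (gram n' E (z div q) (w div q)) (gram m' F (z mod q) (w mod q)) a b"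
    unfolding fkron_def gram_def sum_product .
qed

text \<open>This is S(N \<otimes> M) = S(N) \<otimes> S(M) at the level of generators. It transfers
  the tensor results on abstract generator sets to channels.\<close>

lemma grams_kraus_tensor:
  "grams (n' * m') (p * q) (kraus_tensor q m' m E F) = gens_tensor m (grams n' p E) (grams m' q F)"
proof (intro subset_antisym subsetI)
  fix g assume "g \<in> grams (n' * m') (p * q) (kraus_tensor q m' m E F)"
  then obtain z w where zw: "z < p * q" "w < p * q"
    "g = fkron m (gram n' E (z div q) (w div q)) (gram m' F (z mod q) (w mod q))"
    unfolding grams_def gram_kraus_tensor by blast
  then have "0 < q" by (metis mult_0_right not_less_zero neq0_conv)
  then have "z div q < p" "w div q < p" "z mod q < q" "w mod q < q"
    using zw(1,2) by (simp_all add: less_mult_imp_div_less)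
  then show "g \<in> gens_tensor m (grams n' p E) (grams m' q F)"
    unfolding gens_tensor_def grams_def zw(3) by blast
next
  fix g assume "g \<in> gens_tensor m (grams n' p E) (grams m' q F)"
  then obtain x x' y y' where *: "x < p" "x' < p" "y < q" "y' < q"
    "g = fkron m (gram n' E x x') (gram m' F y y')"
    unfolding gens_tensor_def grams_def by blast
  have "g = gram (n' * m') (kraus_tensor q m' m E F) (x * q + y) (x' * q + y')"
    unfolding gram_kraus_tensor using * by simp
  then show "g \<in> grams (n' * m') (p * q) (kraus_tensor q m' m E F)"
    unfolding grams_def using mult_add_less_mult * by blast
qed

lemma exact_channel_tensor:
  assumes "exact_channel N r" "exact_channel M s"
  shows "exact_channel (tensor_channel N M) (r * s)"
proof -
  obtain p E \<psi> where N: "kraus_fun N p E" "generic_rank (in_dim N) (grams (out_dim N) p E) r"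
    "independent_vectors (in_dim N) (grams (out_dim N) p E) r \<psi>"
    using assms(1) unfolding exact_channel_def by blast
  obtain q F \<phi> where M: "kraus_fun M q F" "generic_rank (in_dim M) (grams (out_dim M) q F) s"
    "independent_vectors (in_dim M) (grams (out_dim M) q F) s \<phi>"
    using assms(2) unfolding exact_channel_def by blast
  have dims: "in_dim (tensor_channel N M) = in_dim N * in_dim M"
    "out_dim (tensor_channel N M) = out_dim N * out_dim M"
    by (simp_all add: tensor_channel_def)
  show ?thesis
    unfolding exact_channel_def dims
  proof (intro exI conjI)
    show "kraus_fun (tensor_channel N M) (p * q) (kraus_tensor q (out_dim M) (in_dim M) E F)"
      by (rule kraus_fun_tensor [OF N(1) M(1)])
  qed (unfold grams_kraus_tensor, rule generic_rank_tensor [OF N(2) M(2)],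
      rule independent_vectors_tensor [OF N(3) M(3)])
qed

lemma exact_channel_id_1: "exact_channel (id_channel 1) 1"
proof -
  have K: "kraus_fun (id_channel 1) 1 (\<lambda>_. fid)"
    by (auto simp: kraus_fun_def id_channel_def fid_def)
  have "gram 1 (\<lambda>_. fid) 0 0 \<in> grams 1 1 (\<lambda>_. fid)"
    unfolding grams_def by blast
  then have "in_hull 1 (grams 1 1 (\<lambda>_. fid)) fid"
    by (rule in_hull_cong [OF in_hull_base]) (simp add: gram_def fid_def)
  then have "generic_rank 1 (grams 1 1 (\<lambda>_. fid)) 1"
    by (rule generic_rank_dim)
  moreover have "in_dim (id_channel 1) = 1" "out_dim (id_channel 1) = 1"
    by (simp_all add: id_channel_def)
  moreover have "independent_vectors 1 (grams 1 1 (\<lambda>_. fid)) 1 (\<lambda>_ _. 1)"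
    by (rule independent_vectors_single) simp
  ultimately show ?thesis
    unfolding exact_channel_def using K by metis
qed

lemma exact_channel_power:
  assumes "exact_channel N r"
  shows "exact_channel (tensor_power N k) (r ^ k)"
  by (induction k) (use assms exact_channel_id_1 exact_channel_tensor in auto)

lemma independence_number_exact: "exact_channel N r \<Longrightarrow> independence_number N = r"
  unfolding exact_channel_def using independence_number_eq by blast

lemma zero_error_capacity_exact:
  assumes "exact_channel N r" "0 < r"
  shows "zero_error_capacity N = log 2 (real r)"
proof -
  \<comment> \<open>The sequence is constant from \<open>k = 1\<close> on; at \<open>k = 0\<close>
    the quotient is 0 by the convention for division by zero.\<close>
  have "one_shot_zero_error_capacity (tensor_power N k) / real k = log 2 (real r)" if "0 < k" for k
    using that independence_number_exact [OF exact_channel_power [OF assms(1), of k]] assms(2)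
    by (simp add: one_shot_zero_error_capacity_def log_nat_power)
  then have "\<forall>\<^sub>F k in sequentially.
      one_shot_zero_error_capacity (tensor_power N k) / real k = log 2 (real r)"
    using eventually_gt_at_top [of "0::nat"] by (rule eventually_mono [rotated])
  then have "(\<lambda>k. one_shot_zero_error_capacity (tensor_power N k) / real k) \<longlonglongrightarrow> log 2 (real r)"
    by (rule tendsto_eventually)
  then show ?thesis unfolding zero_error_capacity_def by (rule limI)
qed

text \<open>Trace preservation at the matrix unit E_ba is entry (a, b) of the completeness relation:
  the sum of all E_x^\<dagger> E_x is the identity.\<close>

lemma in_hull_grams_fid:
  assumes K: "kraus_fun N p E" and TP: "trace_preserving N"
  shows "in_hull (in_dim N) (grams (out_dim N) p E) fid"
  unfolding in_hull_def
proof (intro allI impI)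
  let ?n = "in_dim N" and ?m = "out_dim N"
  fix c assume c: "\<forall>g\<in>grams ?m p E. pairing ?n c g = 0"
  have "fid a b = (\<Sum>x<p. 1 * gram ?m E x x a b)" if ab: "a < ?n" "b < ?n" for a b
  proof -
    have "chan_map N (mat_unit ?n b a) \<in> carrier_mat ?m ?m"
      using K mat_unit_carrier unfolding kraus_fun_def by blast
    then have "mat_trace (chan_map N (mat_unit ?n b a)) = (\<Sum>r<?m. \<Sum>x<p. E x r b * cnj (E x r a))"
      unfolding mat_trace_def using kraus_fun_mat_unit [OF K _ _ ab(2,1)] by simp
    also have "\<dots> = (\<Sum>x<p. \<Sum>r<?m. E x r b * cnj (E x r a))"
      by (rule sum.swap)
    also have "\<dots> = (\<Sum>x<p. 1 * gram ?m E x x a b)"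
      unfolding gram_def by (simp add: mult.commute)
    finally have "(\<Sum>x<p. 1 * gram ?m E x x a b) = mat_trace (mat_unit ?n b a)"
      using TP mat_unit_carrier unfolding trace_preserving_def by metis
    also have "\<dots> = (\<Sum>i<?n. if i = a then fid a b else 0)"
      unfolding mat_trace_def using ab carrier_matD [OF mat_unit_carrier [of ?n b a]]
      by (auto simp: index_mat_unit fid_def intro!: sum.cong)
    also have "\<dots> = fid a b" using ab by simp
    finally show ?thesis by simp
  qed
  then have "pairing ?n c fid = pairing ?n c (\<lambda>a b. \<Sum>x<p. 1 * gram ?m E x x a b)"
    by (rule pairing_cong)
  also have "\<dots> = 0"
    unfolding pairing_sum using c unfolding ball_grams by simp
  finally show "pairing ?n c fid = 0" .
qed

lemma fadj_grams: "g \<in> grams m p E \<Longrightarrow> fadj g \<in> grams m p E"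
proof -
  have "fadj (gram m E x y) = gram m E y x" for x y
    unfolding fadj_def gram_def by (simp add: mult.commute)
  then show "g \<in> grams m p E \<Longrightarrow> fadj g \<in> grams m p E" unfolding grams_def by auto
qed

lemma exact_channel_qubit:
  assumes "quantum_channel N" "in_dim N = 2"
  shows "\<exists>r>0. exact_channel N r"
proof -
  obtain p E where K: "kraus_fun N p E"
    using choi assms(1) unfolding quantum_channel_def by blast
  have "in_hull 2 (grams (out_dim N) p E) fid"
    using in_hull_grams_fid [OF K] assms unfolding quantum_channel_def by simp
  then obtain r where "r \<in> {1, 2}" "generic_rank 2 (grams (out_dim N) p E) r"
    "\<exists>\<psi>. independent_vectors 2 (grams (out_dim N) p E) r \<psi>"
    using qubit_dichotomy [OF _ fadj_grams] by blast
  then show ?thesis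
    using K assms(2) unfolding exact_channel_def by (intro exI [of _ r]) auto
qed

theorem corollary10:
  fixes N1 N2 :: channel
  assumes "quantum_channel N1" and "in_dim N1 = 2"
    and "quantum_channel N2" and "in_dim N2 = 2"
  shows "\<not> ((zero_error_capacity N1 = 0 \<or> zero_error_capacity N2 = 0) \<and>
            zero_error_capacity (tensor_channel N1 N2)
              > zero_error_capacity N1 + zero_error_capacity N2)"
proof -
  obtain r s where r: "0 < r" "exact_channel N1 r" and s: "0 < s" "exact_channel N2 s"
    using exact_channel_qubit assms by meson
  \<comment> \<open>Exact values multiply under tensor products, so their logarithms add and the
    strict inequality fails.\<close>
  have "zero_error_capacity (tensor_channel N1 N2) = log 2 (real (r * s))"
    using r(1) s(1) by (intro zero_error_capacity_exact exact_channel_tensor r(2) s(2)) simp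
  also have "\<dots> = zero_error_capacity N1 + zero_error_capacity N2"
    using r(1) s(1) zero_error_capacity_exact [OF r(2,1)] zero_error_capacity_exact [OF s(2,1)]
    by (simp add: log_mult)
  finally show ?thesis by simp
qed

end
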